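(* Let $f\in L^1[0,\pi]$ have zero mean and suppose $u$ and $v$ solve the Poisson problems $$-u''=f \ \text{ in } (0,\pi),\qquad u'(0)=u'(\pi)=0,$$ $$-v''=f^{\ast} \ \text{ in } (0,\pi),\qquad v'(0)=v'(\pi)=0,$$ where $f^{\ast}$ is the decreasing rearrangement of $f$. If $u$ and $v$ both have zero mean, then $$\int_0^{\pi}\phi(u)\,dx\le\int_0^{\pi}\phi(v)\,dx$$ for each convex function $\phi:\mathbb{R}\to\mathbb{R}$. In particular, $$\|u\|_{L^p[0,\pi]}\le\|v\|_{L^p[0,\pi]},\qquad 1\le p\le+\infty,$$ $$\max_{[0,\pi]}u\le\max_{[0,\pi]}v,\qquad \min_{[0,\pi]}v\le\min_{[0,\pi]}u,\qquad \operatorname{osc}_{[0,\pi]}u\le\operatorname{osc}_{[0,\pi]}v.$$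
   Context: Rearrangement: for $X\subseteq\mathbb{R}$ measurable of finite length $|X|$ and $f\in L^1(X)$, the decreasing rearrangement $f^{\ast}:[0,|X|]\to[-\infty,+\infty]$ is defined by $f^{\ast}(0)=\operatorname{ess\,sup}_X f$, $f^{\ast}(t)=\inf\{s: |\{x\in X: s<f(x)\}|\le t\}$ for $t\in(0,|X|)$, and $f^{\ast}(|X|)=\operatorname{ess\,inf}_X f$. Here $X=[0,\pi]$. Zero mean for a function $g$ on $[0,\pi]$ means $\int_0^\pi g\,dx=0$. The oscillation is $\operatorname{osc}=\max-\min$. Solutions: a solution of $-u''=f$ in $(0,\pi)$ with the given boundary conditions means a function $u\in C^1[0,\pi]$ such that $u'$ is absolutely continuous on $[0,\pi]$, $-u''=f$ a.e. on $(0,\pi)$, and the boundary conditions hold. *)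

theory Defs
  imports "HOL-Analysis.Analysis" "HOL-Probability.Essential_Supremum"
begin

definition essinf :: "'a measure \<Rightarrow> ('a \<Rightarrow> ereal) \<Rightarrow> ereal" where
  "essinf M f = - esssup M (\<lambda>x. - f x)"

text \<open>Meaningful for \<^term>\<open>X\<close> of finite Lebesgue measure and \<^term>\<open>t\<close> between 0 and that measure.
  The end point values may be infinite.\<close>

definition decr_rearr :: "real set \<Rightarrow> (real \<Rightarrow> real) \<Rightarrow> real \<Rightarrow> ereal" where
  "decr_rearr X f t =
    (if t = 0 then esssup (lebesgue_on X) (\<lambda>x. ereal (f x))
     else if t = measure lebesgue X then essinf (lebesgue_on X) (\<lambda>x. ereal (f x))
     else Inf (ereal ` {s. measure lebesgue {x \<in> X. s < f x} \<le> t}))"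

definition abs_continuous_on_interval :: "real \<Rightarrow> real \<Rightarrow> (real \<Rightarrow> real) \<Rightarrow> bool" where
  "abs_continuous_on_interval l r g \<longleftrightarrow>
    (\<forall>\<epsilon>>0. \<exists>\<delta>>0. \<forall>(n::nat) a b.
       (\<forall>i<n. l \<le> a i \<and> a i < b i \<and> b i \<le> r) \<longrightarrow>
       disjoint_family_on (\<lambda>i. {a i<..<b i}) {..<n} \<longrightarrow>
       (\<Sum>i<n. b i - a i) < \<delta> \<longrightarrow>
       (\<Sum>i<n. \<bar>g (b i) - g (a i)\<bar>) < \<epsilon>)"

text \<open>The right-hand side is extended-real-valued so that a rearrangement can be used directly;
  the equation forces it to be finite almost everywhere. Differentiation within the closed
  interval gives one-sided derivatives at the end points, and no condition is imposed
  on \<^term>\<open>u\<close> outside the interval.\<close>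

definition neumann_solution :: "(real \<Rightarrow> ereal) \<Rightarrow> (real \<Rightarrow> real) \<Rightarrow> bool" where
  "neumann_solution F u \<longleftrightarrow>
    (\<exists>u'. (\<forall>x\<in>{0..pi}. (u has_real_derivative u' x) (at x within {0..pi})) \<and>
          continuous_on {0..pi} u' \<and>
          abs_continuous_on_interval 0 pi u' \<and>
          (AE x in lebesgue_on {0<..<pi}.
             \<exists>D. (u' has_real_derivative D) (at x) \<and> ereal (- D) = F x) \<and>
          u' 0 = 0 \<and> u' pi = 0)"

definition zero_mean :: "(real \<Rightarrow> real) \<Rightarrow> bool" where
  "zero_mean g \<longleftrightarrow> (LINT x|lebesgue_on {0..pi}. g x) = 0"

text \<open>The exponent ranges over \<open>[1, \<infinity>]\<close>; the norm of a function outside \<open>L\<^sup>p\<close> is infinite.\<close>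

definition Lp_norm :: "ennreal \<Rightarrow> 'a measure \<Rightarrow> ('a \<Rightarrow> real) \<Rightarrow> ennreal" where
  "Lp_norm p M g =
    (if p = \<infinity> then esssup M (\<lambda>x. ennreal \<bar>g x\<bar>)
     else let I = (\<integral>\<^sup>+x. ennreal (\<bar>g x\<bar> powr enn2real p) \<partial>M)
          in if I = \<infinity> then \<infinity> else ennreal (enn2real I powr (1 / enn2real p)))"

text \<open>Maximum and minimum in the literal sense: the greatest and least attained value. They are
  unspecified if not attained, which does not occur for continuous functions
  on a nonempty compact set.\<close>

definition max_on :: "'a set \<Rightarrow> ('a \<Rightarrow> real) \<Rightarrow> real" where
  "max_on S g = (GREATEST y. y \<in> g ` S)"

definition min_on :: "'a set \<Rightarrow> ('a \<Rightarrow> real) \<Rightarrow> real" where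
  "min_on S g = (LEAST y. y \<in> g ` S)"

definition osc_on :: "'a set \<Rightarrow> ('a \<Rightarrow> real) \<Rightarrow> real" where
  "osc_on S g = max_on S g - min_on S g"

end

theory Submission
  imports Defs "HOL-Probability.Distribution_Functions"
begin

text \<open>Write \<open>|A|\<close> for the length of \<open>A\<close>, let \<open>r\<close> be the decreasing rearrangement of \<open>u\<close> on the interval
from \<open>0\<close> to \<open>\<pi>\<close>, and put \<open>G \<tau> = \<integral>\<^sub>0\<^sup>\<tau> f\<^sup>*\<close>, so that \<open>v' = - G\<close>. The theorem rests on one fact: \<open>v - r\<close>
is decreasing. Since \<open>r\<close> is decreasing and has the same mean as \<open>v\<close>, the graph of \<open>v\<close> then lies above
that of \<open>r\<close> at large values of \<open>r\<close> and below it at small ones, and a supporting line of \<open>\<phi>\<close> at the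
crossing level gives \<open>\<integral> \<phi>(r) \<le> \<integral> \<phi>(v)\<close> (lemma \<open>integral_convex_le_if_difference_comonotone\<close>).
Because \<open>u\<close> and \<open>r\<close> are equimeasurable, \<open>\<integral> \<phi>(r) = \<integral> \<phi>(u)\<close>. The norms, the maximum and the minimum
follow by choosing powers and hinge functions for \<open>\<phi>\<close>.

That \<open>v - r\<close> is decreasing says \<open>- r' \<le> G\<close>. Heuristically, let \<open>\<tau> = |{u > c}|\<close>. Integrating the
equation over \<open>{u > c}\<close> shows that the sum of \<open>|u'|\<close> over the points of \<open>{u = c}\<close> is
\<open>\<integral>\<^bsub>{u > c}\<^esub> f \<le> G \<tau>\<close>; the Neumann conditions remove any contribution of the end points. The sum of
\<open>1 / |u'|\<close> over the same points is \<open>- 1 / r'(\<tau>)\<close>. As there is at least one such point, the product of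
the two sums is at least \<open>1\<close>, which is the claim.

Level sets may be irregular, so the proof works with a band \<open>c < u < d\<close> instead of a level. Testing the
equation with the truncation of \<open>u\<close> bounds \<open>\<integral> (u')\<^sup>2\<close> over the band by \<open>(d - c) * G \<tau>\<close> (lemmas
\<open>dirichlet_energy_of_band\<close> and \<open>bathtub\<close>), while \<open>u\<close> has to cross the band, so \<open>d - c\<close> is at
most \<open>\<integral> |u'|\<close> over it (lemma \<open>gap_le_variation_on_band\<close>). The arithmetic-geometric mean inequality
turns this into \<open>d - c \<le> K * |{c < u < d}|\<close> for each \<open>K > G \<tau>\<close>, which is the differential inequality
in integrated form (lemmas \<open>gap_le_band_measure\<close> and \<open>quantile_increment_le\<close>).\<close>

section \<open>Absolutely continuous functions\<close>

lemma abs_continuous_on_interval_family: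
  assumes "abs_continuous_on_interval l r g" "\<epsilon> > 0"
  obtains \<delta> where "\<delta> > 0"
    "\<And>I (a::'i \<Rightarrow> real) b. \<lbrakk>finite I; \<And>i. i \<in> I \<Longrightarrow> l \<le> a i \<and> a i < b i \<and> b i \<le> r;
       disjoint_family_on (\<lambda>i. {a i<..<b i}) I; (\<Sum>i\<in>I. b i - a i) < \<delta>\<rbrakk>
       \<Longrightarrow> (\<Sum>i\<in>I. \<bar>g (b i) - g (a i)\<bar>) < \<epsilon>"
proof -
  obtain \<delta> where "\<delta> > 0" and \<delta>: "\<And>(n::nat) a b.
       (\<forall>i<n. l \<le> a i \<and> a i < b i \<and> b i \<le> r) \<Longrightarrow>
       disjoint_family_on (\<lambda>i. {a i<..<b i}) {..<n} \<Longrightarrow>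
       (\<Sum>i<n. b i - a i) < \<delta> \<Longrightarrow>
       (\<Sum>i<n. \<bar>g (b i) - g (a i)\<bar>) < \<epsilon>"
    using assms unfolding abs_continuous_on_interval_def by meson
  show ?thesis
  proof (rule that[OF \<open>\<delta> > 0\<close>])
    fix I and a b :: "'i \<Rightarrow> real"
    assume I: "finite I" "\<And>i. i \<in> I \<Longrightarrow> l \<le> a i \<and> a i < b i \<and> b i \<le> r"
      "disjoint_family_on (\<lambda>i. {a i<..<b i}) I" "(\<Sum>i\<in>I. b i - a i) < \<delta>"
    obtain h where h: "bij_betw h {..<card I} I"
      using \<open>finite I\<close> ex_bij_betw_nat_finite lessThan_atLeast0 by metis
    have "(\<Sum>i<card I. \<bar>g (b (h i)) - g (a (h i))\<bar>) < \<epsilon>"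
    proof (rule \<delta>)
      show "\<forall>i<card I. l \<le> a (h i) \<and> a (h i) < b (h i) \<and> b (h i) \<le> r"
        using I(2) bij_betwE[OF h] by auto
      show "disjoint_family_on (\<lambda>i. {a (h i)<..<b (h i)}) {..<card I}"
        using I(3) bij_betwE[OF h] bij_betw_imp_inj_on[OF h]
        unfolding disjoint_family_on_def inj_on_def by metis
      show "(\<Sum>i<card I. b (h i) - a (h i)) < \<delta>"
        using I(4) sum.reindex_bij_betw[OF h, of "\<lambda>i. b i - a i"] by simp
    qed
    then show "(\<Sum>i\<in>I. \<bar>g (b i) - g (a i)\<bar>) < \<epsilon>"
      using sum.reindex_bij_betw[OF h, of "\<lambda>i. \<bar>g (b i) - g (a i)\<bar>"] by simp
  qed
qed

text \<open>The fundamental theorem of calculus for absolutely continuous functions, obtained directly for the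
gauge integral. Overwrite \<open>D\<close> by \<open>0\<close> on the exceptional null set \<open>N\<close>. At tags outside \<open>N\<close> the
usual straddle estimate applies. At tags in \<open>N\<close> the gauge confines the intervals to an open
neighbourhood \<open>T\<close> of \<open>N\<close> of small measure; those intervals contribute nothing to the Riemann sum,
and by absolute continuity \<open>g\<close> varies little over them.\<close>

lemma abs_continuous_ftc:
  fixes g D :: "real \<Rightarrow> real"
  assumes ac: "abs_continuous_on_interval a b g" and "a \<le> b" and N: "negligible N"
    and der: "\<And>x. x \<in> {a..b} - N \<Longrightarrow> (g has_real_derivative D x) (at x within {a..b})"
  shows "(D has_integral (g b - g a)) {a..b}"
proof -
  define D' where "D' x = (if x \<in> N then 0 else D x)" for x
  have "(D' has_integral (g b - g a)) (cbox a b)"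
    unfolding has_integral
  proof (intro allI impI)
    fix e :: real assume "e > 0"
    obtain \<delta> where "\<delta> > 0" and \<delta>: "\<And>I (l::real \<times> real set \<Rightarrow> real) r. \<lbrakk>finite I;
       \<And>i. i \<in> I \<Longrightarrow> a \<le> l i \<and> l i < r i \<and> r i \<le> b;
       disjoint_family_on (\<lambda>i. {l i<..<r i}) I; (\<Sum>i\<in>I. r i - l i) < \<delta>\<rbrakk>
       \<Longrightarrow> (\<Sum>i\<in>I. \<bar>g (r i) - g (l i)\<bar>) < e / 2"
      using abs_continuous_on_interval_family[OF ac half_gt_zero[OF \<open>e > 0\<close>]] by blast
    obtain T where T: "open T" "N \<subseteq> T" "T - N \<in> lmeasurable" "emeasure lebesgue (T - N) < ennreal \<delta>"
      using sets_lebesgue_outer_open[OF negligible_imp_sets[OF N] \<open>\<delta> > 0\<close>] .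
    have "T = (T - N) \<union> N" using T by blast
    then have Tm: "T \<in> lmeasurable"
      using T(3) negligible_imp_measurable[OF N] by (metis fmeasurable.Un)
    have mT: "measure lebesgue T < \<delta>"
    proof -
      have "measure lebesgue T = measure lebesgue (T - N)"
        using N Tm by (intro measure_Diff_null_set[symmetric]) (auto simp: negligible_iff_null_sets)
      also have "\<dots> < \<delta>"
        using T(3,4) \<open>\<delta> > 0\<close> by (simp add: emeasure_eq_measure2 ennreal_less_iff)
      finally show ?thesis .
    qed
    \<comment> \<open>The summand 1 keeps the denominator positive when \<open>a = b\<close>.\<close>
    define \<epsilon> where "\<epsilon> = e / (2 * (b - a + 1))"
    have "\<epsilon> > 0" using \<open>e > 0\<close> \<open>a \<le> b\<close> by (simp add: \<epsilon>_def)
    have "\<exists>d>0. \<forall>y\<in>{a..b}. \<bar>y - x\<bar> < d \<longrightarrow> \<bar>g y - g x - D x * (y - x)\<bar> \<le> \<epsilon> * \<bar>y - x\<bar>"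
      if "x \<in> {a..b} - N" for x
      using der[OF that] \<open>\<epsilon> > 0\<close>
      unfolding has_field_derivative_def has_derivative_within_alt by (auto simp: real_norm_def)
    then obtain d where d: "\<And>x. x \<in> {a..b} - N \<Longrightarrow> d x > 0"
      "\<And>x y. x \<in> {a..b} - N \<Longrightarrow> y \<in> {a..b} \<Longrightarrow> \<bar>y - x\<bar> < d x \<Longrightarrow>
        \<bar>g y - g x - D x * (y - x)\<bar> \<le> \<epsilon> * \<bar>y - x\<bar>"
      by metis
    define \<gamma> where "\<gamma> x = (if x \<in> N then T else if x \<in> {a..b} then ball x (d x) else UNIV)" for x
    have gauge: "gauge \<gamma>"
      unfolding gauge_def \<gamma>_def using T(1,2) d(1) by auto
    have est: "norm ((\<Sum>(x, K)\<in>p. measure lborel K *\<^sub>R D' x) - (g b - g a)) < e"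
      if p: "p tagged_division_of cbox a b" "\<gamma> fine p" for p
    proof -
      define l where "l = (\<lambda>(x::real, K). Inf K :: real)"
      define r where "r = (\<lambda>(x::real, K). Sup K :: real)"
      note pD = tagged_division_ofD[OF p(1)]
      have K: "K = {l (x,K)..r (x,K)} \<and> l (x,K) \<le> x \<and> x \<le> r (x,K) \<and> a \<le> l (x,K) \<and> r (x,K) \<le> b
          \<and> measure lborel K = r (x,K) - l (x,K) \<and> interior K = {l (x,K)<..<r (x,K)}"
        if xK: "(x, K) \<in> p" for x K
      proof -
        obtain s t where "K = {s..t}" using pD(4)[OF xK] by auto
        moreover have "x \<in> K" "K \<subseteq> {a..b}" using pD(2,3)[OF xK] by auto
        ultimately show ?thesis by (auto simp: l_def r_def interior_atLeastAtMost_real)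
      qed
      \<comment> \<open>Telescoping: the increment of \<open>g\<close> over \<open>{a..b}\<close> is distributed over the division.\<close>
      have tel: "(\<Sum>i\<in>p. g (r i) - g (l i)) = g b - g a"
        using additive_tagged_division_1[OF \<open>a \<le> b\<close>, of p g] p(1)
        by (simp add: l_def r_def case_prod_unfold)
      define P where "P = {i \<in> p. fst i \<in> N}"
      define Q where "Q = {i \<in> p. fst i \<notin> N}"
      have PQ: "p = P \<union> Q" "P \<inter> Q = {}" "finite P" "finite Q"
        using pD(1) by (auto simp: P_def Q_def)
      let ?t = "\<lambda>i. measure lborel (snd i) * D' (fst i) - (g (r i) - g (l i))"
      have "(\<Sum>(x, K)\<in>p. measure lborel K *\<^sub>R D' x) - (g b - g a) = (\<Sum>i\<in>p. ?t i)"
        using tel by (simp add: case_prod_unfold sum_subtractf)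
      also have "\<dots> = sum ?t P + sum ?t Q"
        using PQ by (simp add: sum.union_disjoint)
      finally have split: "norm ((\<Sum>(x, K)\<in>p. measure lborel K *\<^sub>R D' x) - (g b - g a))
          \<le> \<bar>sum ?t P\<bar> + \<bar>sum ?t Q\<bar>" by simp
      have "\<bar>sum ?t P\<bar> \<le> (\<Sum>i\<in>P. \<bar>g (r i) - g (l i)\<bar>)"
        by (rule sum_abs[THEN order_trans], rule sum_mono) (auto simp: P_def D'_def)
      also have "\<dots> = (\<Sum>i\<in>{i\<in>P. l i < r i}. \<bar>g (r i) - g (l i)\<bar>)"
      proof (intro sum.mono_neutral_right ballI)
        fix i assume i: "i \<in> P - {i \<in> P. l i < r i}"
        then have "l i \<le> r i" using K[of "fst i" "snd i"] by (auto simp: P_def)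
        with i show "\<bar>g (r i) - g (l i)\<bar> = 0" by auto
      qed (use PQ(3) in auto)
      also have "\<dots> < e / 2"
      proof (rule \<delta>)
        let ?P = "{i \<in> P. l i < r i}"
        show fin: "finite ?P" using PQ(3) by simp
        show "a \<le> l i \<and> l i < r i \<and> r i \<le> b" if "i \<in> ?P" for i
          using that K[of "fst i" "snd i"] by (auto simp: P_def)
        show disj: "disjoint_family_on (\<lambda>i. {l i<..<r i}) ?P"
          unfolding disjoint_family_on_def
        proof (intro ballI impI)
          fix i j assume ij: "i \<in> ?P" "j \<in> ?P" "i \<noteq> j"
          then have "interior (snd i) \<inter> interior (snd j) = {}"
            using pD(5)[of "fst i" "snd i" "fst j" "snd j"] by (auto simp: P_def)
          then show "{l i<..<r i} \<inter> {l j<..<r j} = {}"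
            using ij K[of "fst i" "snd i"] K[of "fst j" "snd j"] by (auto simp: P_def)
        qed
        have "(\<Sum>i\<in>?P. r i - l i) = (\<Sum>i\<in>?P. measure lebesgue {l i<..<r i})"
          by (rule sum.cong) auto
        also have "\<dots> = measure lebesgue (\<Union>i\<in>?P. {l i<..<r i})"
          by (rule measure_finite_Union[symmetric]) (use fin disj in auto)
        also have "\<dots> \<le> measure lebesgue T"
        proof (rule measure_mono_fmeasurable[OF _ _ Tm])
          show "(\<Union>i\<in>?P. {l i<..<r i}) \<subseteq> T"
          proof (rule UN_least)
            fix i assume i: "i \<in> ?P"
            then have "snd i \<subseteq> \<gamma> (fst i)" using p(2) by (force simp: P_def fine_def)
            then show "{l i<..<r i} \<subseteq> T"
              using i K[of "fst i" "snd i"] by (force simp: P_def \<gamma>_def)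
          qed
          show "(\<Union>i\<in>?P. {l i<..<r i}) \<in> sets lebesgue" using fin by auto
        qed
        finally show "(\<Sum>i\<in>?P. r i - l i) < \<delta>" using mT by simp
      qed
      finally have P: "\<bar>sum ?t P\<bar> < e / 2" .
      have "\<bar>sum ?t Q\<bar> \<le> (\<Sum>i\<in>Q. \<epsilon> * measure lborel (snd i))"
      proof (rule sum_abs[THEN order_trans], rule sum_mono)
        fix i assume "i \<in> Q"
        obtain x k where i: "i = (x, k)" by force
        with \<open>i \<in> Q\<close> have xk: "(x, k) \<in> p" "x \<notin> N" by (auto simp: Q_def)
        note Kx = K[OF xk(1)]
        have x: "x \<in> {a..b} - N" using Kx xk by auto
        have "k \<subseteq> \<gamma> x" using p(2) xk by (auto simp: fine_def)
        then have "k \<subseteq> ball x (d x)" using xk x by (simp add: \<gamma>_def)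
        moreover have "l i \<in> k" "r i \<in> k" using Kx i by auto
        ultimately have near: "\<bar>l i - x\<bar> < d x" "\<bar>r i - x\<bar> < d x"
          by (auto simp: dist_real_def subset_iff abs_minus_commute)
        have "\<bar>g (l i) - g x - D x * (l i - x)\<bar> \<le> \<epsilon> * (x - l i)"
          using d(2)[OF x _ near(1)] Kx i by auto
        moreover have "\<bar>g (r i) - g x - D x * (r i - x)\<bar> \<le> \<epsilon> * (r i - x)"
          using d(2)[OF x _ near(2)] Kx i by auto
        moreover have "?t i = (g (l i) - g x - D x * (l i - x)) - (g (r i) - g x - D x * (r i - x))"
        proof -
          have "measure lborel k = r i - l i" using Kx i by blast
          then have "?t i = (r i - l i) * D x - (g (r i) - g (l i))"
            using i xk(2) by (simp add: D'_def)
          then show ?thesis by (simp add: algebra_simps)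
        qed
        moreover have "\<epsilon> * measure lborel (snd i) = \<epsilon> * (x - l i) + \<epsilon> * (r i - x)"
        proof -
          have "measure lborel k = r i - l i" using Kx i by blast
          then have "\<epsilon> * measure lborel (snd i) = \<epsilon> * (r i - l i)" using i by simp
          then show ?thesis by (simp add: algebra_simps)
        qed
        ultimately show "\<bar>?t i\<bar> \<le> \<epsilon> * measure lborel (snd i)" by linarith
      qed
      also have "\<dots> \<le> (\<Sum>i\<in>p. \<epsilon> * measure lborel (snd i))"
        using PQ pD(1) \<open>\<epsilon> > 0\<close> by (intro sum_mono2) auto
      also have "\<dots> = \<epsilon> * (b - a)"
        using additive_content_tagged_division[OF p(1)] \<open>a \<le> b\<close>
        by (simp add: case_prod_unfold flip: sum_distrib_left)
      also have "\<dots> \<le> e / 2"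
        unfolding \<epsilon>_def using \<open>e > 0\<close> \<open>a \<le> b\<close> by (simp add: field_simps)
      finally show ?thesis using P split by linarith
    qed
    show "\<exists>\<gamma>. gauge \<gamma> \<and> (\<forall>p. p tagged_division_of cbox a b \<and> \<gamma> fine p \<longrightarrow>
        norm ((\<Sum>(x, K)\<in>p. measure lborel K *\<^sub>R D' x) - (g b - g a)) < e)"
      by (intro exI[of _ \<gamma>] conjI gauge allI impI est) auto
  qed
  then have "(D' has_integral (g b - g a)) {a..b}" by (simp only: box_real)
  then show ?thesis
    by (rule has_integral_spike[OF N, rotated]) (simp only: D'_def Diff_iff if_False)
qed

lemma abs_continuous_subinterval:
  assumes "abs_continuous_on_interval l r g" "l \<le> a" "b \<le> r"
  shows "abs_continuous_on_interval a b g"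
  unfolding abs_continuous_on_interval_def
proof (intro allI impI)
  fix \<epsilon> :: real assume "\<epsilon> > 0"
  then obtain \<delta> where "\<delta> > 0" and \<delta>: "\<And>(n::nat) a b.
       (\<forall>i<n. l \<le> a i \<and> a i < b i \<and> b i \<le> r) \<Longrightarrow>
       disjoint_family_on (\<lambda>i. {a i<..<b i}) {..<n} \<Longrightarrow>
       (\<Sum>i<n. b i - a i) < \<delta> \<Longrightarrow>
       (\<Sum>i<n. \<bar>g (b i) - g (a i)\<bar>) < \<epsilon>"
    using assms(1) unfolding abs_continuous_on_interval_def by meson
  have sub: "\<forall>i<n. l \<le> x i \<and> x i < y i \<and> y i \<le> r"
    if "\<forall>i<n. a \<le> x i \<and> x i < y i \<and> y i \<le> b" for n :: nat and x y
    using that assms(2,3) by (meson order_trans)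
  show "\<exists>\<delta>>0. \<forall>(n::nat) x y.
       (\<forall>i<n. a \<le> x i \<and> x i < y i \<and> y i \<le> b) \<longrightarrow>
       disjoint_family_on (\<lambda>i. {x i<..<y i}) {..<n} \<longrightarrow>
       (\<Sum>i<n. y i - x i) < \<delta> \<longrightarrow>
       (\<Sum>i<n. \<bar>g (y i) - g (x i)\<bar>) < \<epsilon>"
  proof (intro exI[of _ \<delta>] conjI allI impI \<open>\<delta> > 0\<close>)
    fix n :: nat and x y
    assume "\<forall>i<n. a \<le> x i \<and> x i < y i \<and> y i \<le> b"
      "disjoint_family_on (\<lambda>i. {x i<..<y i}) {..<n}" "(\<Sum>i<n. y i - x i) < \<delta>"
    then show "(\<Sum>i<n. \<bar>g (y i) - g (x i)\<bar>) < \<epsilon>" by (intro \<delta> sub)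
  qed
qed

lemma abs_continuous_const: "abs_continuous_on_interval l r (\<lambda>x. k)"
  unfolding abs_continuous_on_interval_def
proof (intro allI impI exI[of _ "1::real"] conjI)
qed simp_all

text \<open>Absolutely continuous functions are closed under multiplication by bounded Lipschitz functions.
This is what makes integration by parts against a truncation of the solution possible.\<close>

lemma abs_continuous_mult_lipschitz:
  fixes g h :: "real \<Rightarrow> real"
  assumes ac: "abs_continuous_on_interval l r g"
    and g: "\<And>x. x \<in> {l..r} \<Longrightarrow> \<bar>g x\<bar> \<le> A"
    and h: "\<And>x. x \<in> {l..r} \<Longrightarrow> \<bar>h x\<bar> \<le> B"
    and lip: "\<And>x y. x \<in> {l..r} \<Longrightarrow> y \<in> {l..r} \<Longrightarrow> \<bar>h x - h y\<bar> \<le> K * \<bar>x - y\<bar>"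
  shows "abs_continuous_on_interval l r (\<lambda>x. g x * h x)"
  unfolding abs_continuous_on_interval_def
proof (intro allI impI)
  fix \<epsilon> :: real assume "\<epsilon> > 0"
  define b where "b = \<bar>B\<bar> + 1"
  define k where "k = \<bar>A\<bar> * \<bar>K\<bar> + 1"
  have "b > 0" by (simp add: b_def)
  have "k > 0" unfolding k_def by (simp add: add_nonneg_pos)
  have "\<epsilon> / (2 * b) > 0" using \<open>\<epsilon> > 0\<close> \<open>b > 0\<close> by simp
  then obtain \<delta> where "\<delta> > 0" and \<delta>: "\<And>(n::nat) a b'.
       (\<forall>i<n. l \<le> a i \<and> a i < b' i \<and> b' i \<le> r) \<Longrightarrow>
       disjoint_family_on (\<lambda>i. {a i<..<b' i}) {..<n} \<Longrightarrow>
       (\<Sum>i<n. b' i - a i) < \<delta> \<Longrightarrow>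
       (\<Sum>i<n. \<bar>g (b' i) - g (a i)\<bar>) < \<epsilon> / (2 * b)"
    using ac unfolding abs_continuous_on_interval_def by meson
  show "\<exists>\<delta>>0. \<forall>(n::nat) a b.
       (\<forall>i<n. l \<le> a i \<and> a i < b i \<and> b i \<le> r) \<longrightarrow>
       disjoint_family_on (\<lambda>i. {a i<..<b i}) {..<n} \<longrightarrow>
       (\<Sum>i<n. b i - a i) < \<delta> \<longrightarrow>
       (\<Sum>i<n. \<bar>g (b i) * h (b i) - g (a i) * h (a i)\<bar>) < \<epsilon>"
  proof (intro exI[of _ "min \<delta> (\<epsilon> / (2 * k))"] conjI allI impI)
    show "0 < min \<delta> (\<epsilon> / (2 * k))" using \<open>\<delta> > 0\<close> \<open>\<epsilon> > 0\<close> \<open>k > 0\<close> by simp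
    fix n :: nat and x y :: "nat \<Rightarrow> real"
    assume xy: "\<forall>i<n. l \<le> x i \<and> x i < y i \<and> y i \<le> r"
      and dis: "disjoint_family_on (\<lambda>i. {x i<..<y i}) {..<n}"
      and len: "(\<Sum>i<n. y i - x i) < min \<delta> (\<epsilon> / (2 * k))"
    have "(\<Sum>i<n. \<bar>g (y i) * h (y i) - g (x i) * h (x i)\<bar>)
        \<le> (\<Sum>i<n. b * \<bar>g (y i) - g (x i)\<bar> + k * (y i - x i))"
    proof (rule sum_mono)
      fix i assume "i \<in> {..<n}"
      then have i: "x i \<in> {l..r}" "y i \<in> {l..r}" "x i < y i" using xy by force+
      have "g (y i) * h (y i) - g (x i) * h (x i)
          = h (y i) * (g (y i) - g (x i)) + g (x i) * (h (y i) - h (x i))"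
        by (simp add: algebra_simps)
      then have "\<bar>g (y i) * h (y i) - g (x i) * h (x i)\<bar>
          \<le> \<bar>h (y i)\<bar> * \<bar>g (y i) - g (x i)\<bar> + \<bar>g (x i)\<bar> * \<bar>h (y i) - h (x i)\<bar>"
        by (metis abs_mult abs_triangle_ineq)
      moreover have "\<bar>h (y i)\<bar> * \<bar>g (y i) - g (x i)\<bar> \<le> b * \<bar>g (y i) - g (x i)\<bar>"
        using h[OF i(2)] by (intro mult_right_mono) (auto simp: b_def)
      moreover have "\<bar>g (x i)\<bar> * \<bar>h (y i) - h (x i)\<bar> \<le> \<bar>A\<bar> * (\<bar>K\<bar> * (y i - x i))"
      proof (rule mult_mono)
        show "\<bar>g (x i)\<bar> \<le> \<bar>A\<bar>" using g[OF i(1)] by simp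
        have "\<bar>h (y i) - h (x i)\<bar> \<le> K * (y i - x i)" using lip[OF i(2,1)] i(3) by simp
        also have "\<dots> \<le> \<bar>K\<bar> * (y i - x i)" using i(3) by (intro mult_right_mono) auto
        finally show "\<bar>h (y i) - h (x i)\<bar> \<le> \<bar>K\<bar> * (y i - x i)" .
      qed simp_all
      moreover have "\<bar>A\<bar> * (\<bar>K\<bar> * (y i - x i)) \<le> k * (y i - x i)"
        using i(3) by (simp add: k_def algebra_simps)
      ultimately show "\<bar>g (y i) * h (y i) - g (x i) * h (x i)\<bar>
          \<le> b * \<bar>g (y i) - g (x i)\<bar> + k * (y i - x i)" by linarith
    qed
    also have "\<dots> = b * (\<Sum>i<n. \<bar>g (y i) - g (x i)\<bar>) + k * (\<Sum>i<n. y i - x i)"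
      by (simp add: sum.distrib sum_distrib_left)
    also have "\<dots> < b * (\<epsilon> / (2 * b)) + k * (\<epsilon> / (2 * k))"
      using \<delta>[OF xy dis] len \<open>b > 0\<close> \<open>k > 0\<close>
      by (intro add_strict_mono mult_strict_left_mono) auto
    also have "\<dots> = \<epsilon>" using \<open>b > 0\<close> \<open>k > 0\<close> by simp
    finally show "(\<Sum>i<n. \<bar>g (y i) * h (y i) - g (x i) * h (x i)\<bar>) < \<epsilon>" .
  qed
qed

section \<open>Lebesgue measure on a compact interval\<close>

lemma finite_measure_Icc: "finite_measure (lebesgue_on {a..b::real})"
  by (rule finite_measure_lebesgue_on) simp

lemma AE_lebesgue_onE:
  assumes "AE x in lebesgue_on S. P x" "S \<in> sets lebesgue"
  obtains N where "negligible N" "\<And>x. x \<in> S - N \<Longrightarrow> P x"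
proof -
  have "AE x in lebesgue. x \<in> S \<longrightarrow> P x"
    using assms by (simp add: AE_restrict_space_iff)
  then obtain N where "N \<in> null_sets lebesgue" "{x \<in> space lebesgue. \<not> (x \<in> S \<longrightarrow> P x)} \<subseteq> N"
    by (rule AE_E3) blast
  then show thesis by (intro that[of N]) (auto simp: negligible_iff_null_sets)
qed

lemma lmeasurable_imp_sets_lebesgue_on:
  assumes "S \<in> lmeasurable" "S \<subseteq> {a..b::real}"
  shows "S \<in> sets (lebesgue_on {a..b})"
  using assms fmeasurableD[OF assms(1)] by (subst sets_restrict_space_iff) auto

lemma
  fixes a b :: real
  assumes "S \<in> sets (lebesgue_on {a..b})"
  shows integrable_indicator_on_Icc: "integrable (lebesgue_on {a..b}) (indicat_real S)"
    and integral_indicator_on_Icc: "(LINT x|lebesgue_on {a..b}. indicat_real S x) = measure lebesgue S"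
proof -
  have S: "S \<subseteq> {a..b}" using sets.sets_into_space[OF assms] by simp
  show "integrable (lebesgue_on {a..b}) (indicat_real S)"
    using assms finite_measure.emeasure_finite[OF finite_measure_Icc, of a b S]
    by (intro integrable_real_indicator) (auto simp: less_top)
  have "(LINT x|lebesgue_on {a..b}. indicat_real S x) = measure (lebesgue_on {a..b}) S"
    using S by (simp add: Int_absorb2)
  also have "\<dots> = measure lebesgue S" by (rule measure_restrict_space) (use S in auto)
  finally show "(LINT x|lebesgue_on {a..b}. indicat_real S x) = measure lebesgue S" .
qed

lemma AE_Icc_interior: "AE t in lebesgue_on {a..b::real}. a < t \<and> t < b"
proof -
  have "{a, b} \<in> null_sets lebesgue"
    using negligible_iff_null_sets negligible_finite by blast
  then have "AE t in lebesgue. t \<notin> {a, b}" by (rule AE_not_in)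
  then have "AE t in lebesgue. t \<in> {a..b} \<longrightarrow> a < t \<and> t < b"
    by eventually_elim (simp add: less_le)
  then show ?thesis by (subst AE_restrict_space_iff) auto
qed

lemma integrable_mult_bounded_on_Icc:
  fixes f h :: "real \<Rightarrow> real"
  assumes f: "integrable (lebesgue_on {a..b}) f" and h: "h \<in> borel_measurable (lebesgue_on {a..b})"
    and bd: "\<And>x. x \<in> {a..b} \<Longrightarrow> \<bar>h x\<bar> \<le> B"
  shows "integrable (lebesgue_on {a..b}) (\<lambda>x. f x * h x)"
proof (rule Bochner_Integration.integrable_bound)
  show "integrable (lebesgue_on {a..b}) (\<lambda>x. B * f x)" using f by simp
  show "(\<lambda>x. f x * h x) \<in> borel_measurable (lebesgue_on {a..b})"
    using f h by (intro borel_measurable_times) auto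
  show "AE x in lebesgue_on {a..b}. norm (f x * h x) \<le> norm (B * f x)"
  proof (rule AE_I2)
    fix x assume "x \<in> space (lebesgue_on {a..b})"
    then have "\<bar>h x\<bar> \<le> \<bar>B\<bar>" using bd[of x] by force
    then show "norm (f x * h x) \<le> norm (B * f x)"
      using mult_right_mono[of "\<bar>h x\<bar>" "\<bar>B\<bar>" "\<bar>f x\<bar>"] by (simp add: abs_mult mult.commute)
  qed
qed

lemma integrable_const_on_Icc: "integrable (lebesgue_on {a..b::real}) (\<lambda>x. c::real)"
  using finite_measure.integrable_const[OF finite_measure_Icc] .

section \<open>Decreasing rearrangement and equimeasurability\<close>

text \<open>The real-valued decreasing rearrangement: the generalised inverse of the distribution function
\<open>c \<mapsto> |{c < g}|\<close>. Only its values for \<open>0 < t < L\<close> are meaningful, which is all that matters almost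
everywhere.\<close>

definition decr_quantile :: "real \<Rightarrow> (real \<Rightarrow> real) \<Rightarrow> real \<Rightarrow> real" where
  "decr_quantile L g t = Inf {c. measure lebesgue {x \<in> {0..L}. c < g x} \<le> t}"

lemma superlevel_lmeasurable:
  fixes g :: "real \<Rightarrow> real"
  assumes "g \<in> borel_measurable (lebesgue_on {0..L})"
  shows "{x \<in> {0..L}. c < g x} \<in> lmeasurable"
proof -
  have "{x \<in> {0..L}. c < g x} = {x \<in> space (lebesgue_on {0..L}). c < g x}" by simp
  also have "\<dots> \<in> sets (lebesgue_on {0..L})"
    by (rule borel_measurable_less[OF borel_measurable_const assms])
  finally have "{x \<in> {0..L}. c < g x} \<in> sets lebesgue"
    by (simp add: sets_restrict_space_iff)
  then show ?thesis
    by (rule bounded_set_imp_lmeasurable[rotated]) (auto intro: bounded_subset[of "{0..L}"])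
qed

context
  fixes L :: real and g :: "real \<Rightarrow> real"
  assumes L: "0 < L" and meas: "g \<in> borel_measurable (lebesgue_on {0..L})"
begin

private abbreviation "m c \<equiv> measure lebesgue {x \<in> {0..L}. c < g x}"

private definition "N = distr (lebesgue_on {0..L}) borel g"

private lemma N_finite_borel: "finite_borel_measure N"
proof -
  interpret finite_measure "lebesgue_on {0..L}" by (rule finite_measure_Icc)
  show ?thesis
    unfolding finite_borel_measure_def finite_borel_measure_axioms_def N_def
    using finite_measure_distr[OF meas] by simp
qed

text \<open>The limits and the right continuity of \<open>c \<mapsto> |{c < g}|\<close> are those of the cumulative distribution
function of the image measure.\<close>

private lemma m_cdf: "m c = L - cdf N c"
proof -
  interpret N: finite_borel_measure N by (rule N_finite_borel)
  have "m c = measure N {c<..}"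
  proof -
    have "measure N {c<..} = measure (lebesgue_on {0..L}) (g -` {c<..} \<inter> {0..L})"
      unfolding N_def using meas by (simp add: measure_distr)
    also have "\<dots> = measure lebesgue (g -` {c<..} \<inter> {0..L})"
      by (rule measure_restrict_space) auto
    also have "g -` {c<..} \<inter> {0..L} = {x \<in> {0..L}. c < g x}" by auto
    finally show ?thesis by simp
  qed
  also have "{c<..} = space N - {..c}" by (auto simp: N_def)
  also have "measure N \<dots> = measure N (space N) - cdf N c"
    unfolding cdf_def by (rule N.finite_measure_compl) (simp add: N_def)
  also have "measure N (space N) = L"
    unfolding N_def using meas L by (simp add: measure_distr measure_restrict_space)
  finally show ?thesis .
qed

text \<open>The Galois connection that characterises the generalised inverse. Right continuity of the
distribution function is what makes the infimum attained.\<close>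

lemma less_decr_quantile_iff:
  assumes t: "0 < t" "t < L"
  shows "c < decr_quantile L g t \<longleftrightarrow> t < m c"
    and "bdd_below {c. m c \<le> t}" "{c. m c \<le> t} \<noteq> {}"
proof -
  interpret N: finite_borel_measure N by (rule N_finite_borel)
  have "measure N (space N) = L"
    unfolding N_def using meas L by (simp add: measure_distr measure_restrict_space)
  then have top: "(cdf N \<longlongrightarrow> L) at_top" using N.cdf_lim_at_top by simp
  have bot: "(cdf N \<longlongrightarrow> 0) at_bot" by (rule N.cdf_lim_at_bot)
  have "\<forall>\<^sub>F c in at_top. cdf N c > L - t" using top t by (intro order_tendstoD) auto
  then obtain c1 where "cdf N c1 > L - t" using eventually_happens by fastforce
  then have "m c1 \<le> t" by (simp only: m_cdf)
  then show ne: "{c. m c \<le> t} \<noteq> {}" by blast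
  have "\<forall>\<^sub>F c in at_bot. cdf N c < L - t" using bot t by (intro order_tendstoD) auto
  then obtain c2 where c2: "cdf N c2 < L - t" using eventually_happens by fastforce
  have anti: "m y \<le> m x" if "x \<le> y" for x y
    using N.cdf_nondecreasing[OF that] by (simp only: m_cdf)
  show bdd: "bdd_below {c. m c \<le> t}"
  proof (rule bdd_belowI)
    fix c assume "c \<in> {c. m c \<le> t}"
    then have "m c \<le> t" by simp
    moreover have "t < m c2" using c2 by (simp only: m_cdf)
    ultimately show "c2 \<le> c" using anti[of c c2] by linarith
  qed
  have gt: "m c \<le> t" if "decr_quantile L g t < c" for c
  proof -
    have "Inf {c. m c \<le> t} < c" using that by (simp add: decr_quantile_def)
    then obtain c' where "c' < c" "m c' \<le> t" using cInf_lessD[OF ne] by blast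
    then show ?thesis using anti[of c' c] by simp
  qed
  have le: "m (decr_quantile L g t) \<le> t"
  proof -
    let ?r = "decr_quantile L g t"
    have "((\<lambda>c. L - cdf N c) \<longlongrightarrow> L - cdf N ?r) (at_right ?r)"
      using N.cdf_is_right_cont[of ?r] by (intro tendsto_intros) (simp add: continuous_within)
    moreover have "\<forall>\<^sub>F c in at_right ?r. L - cdf N c \<le> t"
      using gt unfolding m_cdf eventually_at_right_field by (intro exI[of _ "?r + 1"]) simp
    ultimately show ?thesis
      unfolding m_cdf by (rule tendsto_upperbound) simp
  qed
  show "c < decr_quantile L g t \<longleftrightarrow> t < m c"
  proof
    assume less: "c < decr_quantile L g t"
    show "t < m c"
    proof (rule ccontr)
      assume "\<not> t < m c"
      then have "decr_quantile L g t \<le> c"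
        unfolding decr_quantile_def by (intro cInf_lower bdd) simp
      with less show False by simp
    qed
  next
    assume "t < m c"
    then show "c < decr_quantile L g t" using le anti[of "decr_quantile L g t" c] by linarith
  qed
qed

lemma decr_quantile_antimono:
  assumes "0 < s" "s \<le> t" "t < L"
  shows "decr_quantile L g t \<le> decr_quantile L g s"
proof (rule ccontr)
  assume "\<not> ?thesis"
  then have "decr_quantile L g s < decr_quantile L g t" by simp
  then obtain c where c: "decr_quantile L g s < c" "c < decr_quantile L g t" using dense by blast
  have "t < m c" using c(2) less_decr_quantile_iff(1)[of t c] assms by linarith
  moreover have "\<not> s < m c" using c(1) less_decr_quantile_iff(1)[of s c] assms by linarith
  ultimately show False using assms by linarith
qed

text \<open>By the Galois connection the superlevel set of the rearrangement is the interval from \<open>0\<close> to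
\<open>|{c < g}|\<close>, up to the two end points.\<close>

private lemma superlevel_decr_quantile:
  "{t \<in> {0..L}. c < decr_quantile L g t} \<in> sets lebesgue"
  "emeasure lebesgue {t \<in> {0..L}. c < decr_quantile L g t} = ennreal (m c)"
proof -
  let ?S = "{t \<in> {0..L}. c < decr_quantile L g t}"
  have "m c \<le> measure lebesgue {0..L}"
    by (rule measure_mono_fmeasurable)
       (use superlevel_lmeasurable[OF meas, of c] fmeasurableD in auto)
  then have mL: "m c \<le> L" using L by simp
  define \<mu> where "\<mu> = m c"
  have \<mu>: "\<mu> \<le> L" "0 \<le> \<mu>" using mL by (simp_all only: \<mu>_def measure_nonneg)
  have split: "?S = {0<..<\<mu>} \<union> (?S \<inter> {0, L})"
  proof (rule set_eqI)
    fix t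
    consider "t = 0 \<or> t = L" | "t < 0 \<or> L < t" | "0 < t" "t < L" by linarith
    then show "t \<in> ?S \<longleftrightarrow> t \<in> {0<..<\<mu>} \<union> (?S \<inter> {0, L})"
    proof cases
      case 1
      then show ?thesis using \<mu> by auto
    next
      case 2
      then show ?thesis using \<mu> by auto
    next
      case 3
      have "c < decr_quantile L g t \<longleftrightarrow> t < \<mu>"
        unfolding \<mu>_def by (rule less_decr_quantile_iff(1)[OF 3])
      then show ?thesis using 3 by auto
    qed
  qed
  have null: "?S \<inter> {0, L} \<in> null_sets lebesgue"
    using negligible_iff_null_sets negligible_finite by blast
  have Ioo: "{0<..<\<mu>} \<in> sets lebesgue" by simp
  show "?S \<in> sets lebesgue"
    by (subst split, rule sets.Un[OF Ioo null_setsD2[OF null]])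
  have "emeasure lebesgue ?S = emeasure lebesgue ({0<..<\<mu>} \<union> (?S \<inter> {0, L}))"
    using split by (rule arg_cong)
  also have "\<dots> = emeasure lebesgue {0<..<\<mu>}" by (rule emeasure_Un_null_set[OF Ioo null])
  also have "\<dots> = ennreal \<mu>" using \<mu> by simp
  finally show "emeasure lebesgue ?S = ennreal (m c)" by (simp only: \<mu>_def)
qed

lemma measurable_decr_quantile: "decr_quantile L g \<in> borel_measurable (lebesgue_on {0..L})"
  unfolding borel_measurable_iff_greater
proof
  fix c
  have "{t \<in> space (lebesgue_on {0..L}). c < decr_quantile L g t} = {t \<in> {0..L}. c < decr_quantile L g t}"
    by simp
  moreover have "{t \<in> {0..L}. c < decr_quantile L g t} \<in> sets (lebesgue_on {0..L})"
    using superlevel_decr_quantile(1)[of c] by (subst sets_restrict_space_iff) auto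
  ultimately show "{t \<in> space (lebesgue_on {0..L}). c < decr_quantile L g t} \<in> sets (lebesgue_on {0..L})"
    by (simp only:)
qed

text \<open>Equimeasurability. Both image measures agree on all half-lines, hence everywhere; integrals of
arbitrary Borel functions of \<open>g\<close> may therefore be computed on the rearrangement.\<close>

lemma distr_decr_quantile:
  "distr (lebesgue_on {0..L}) borel (decr_quantile L g) = distr (lebesgue_on {0..L}) borel g"
proof (rule measure_eqI_lessThan)
  have *: "emeasure (distr (lebesgue_on {0..L}) borel h) {c<..} = emeasure lebesgue {x \<in> {0..L}. c < h x}"
    if "h \<in> borel_measurable (lebesgue_on {0..L})" for h :: "real \<Rightarrow> real" and c
  proof -
    have "emeasure (distr (lebesgue_on {0..L}) borel h) {c<..} = emeasure (lebesgue_on {0..L}) (h -` {c<..} \<inter> {0..L})"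
      using that by (simp add: emeasure_distr)
    also have "\<dots> = emeasure lebesgue (h -` {c<..} \<inter> {0..L})"
      by (rule emeasure_restrict_space) auto
    also have "h -` {c<..} \<inter> {0..L} = {x \<in> {0..L}. c < h x}" by auto
    finally show ?thesis .
  qed
  have eq: "emeasure lebesgue {x \<in> {0..L}. c < g x} = ennreal (m c)" for c
    by (rule emeasure_eq_measure2[OF superlevel_lmeasurable[OF meas]])
  show "emeasure (distr (lebesgue_on {0..L}) borel (decr_quantile L g)) {c<..}
      = emeasure (distr (lebesgue_on {0..L}) borel g) {c<..}" for c
    by (simp only: *[OF meas] *[OF measurable_decr_quantile] superlevel_decr_quantile(2) eq)
  show "emeasure (distr (lebesgue_on {0..L}) borel (decr_quantile L g)) {c<..} < \<infinity>" for c
    by (simp only: *[OF measurable_decr_quantile] superlevel_decr_quantile(2)) simp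
qed simp_all

lemma
  assumes "\<phi> \<in> borel_measurable borel"
  shows integrable_decr_quantile_iff:
      "integrable (lebesgue_on {0..L}) (\<lambda>t. \<phi> (decr_quantile L g t) :: real)
        \<longleftrightarrow> integrable (lebesgue_on {0..L}) (\<lambda>x. \<phi> (g x))"
    and integral_decr_quantile:
      "(LINT t|lebesgue_on {0..L}. \<phi> (decr_quantile L g t)) = (LINT x|lebesgue_on {0..L}. \<phi> (g x))"
proof -
  show "integrable (lebesgue_on {0..L}) (\<lambda>t. \<phi> (decr_quantile L g t)) \<longleftrightarrow> integrable (lebesgue_on {0..L}) (\<lambda>x. \<phi> (g x))"
    by (rule trans[OF integrable_distr_eq[OF measurable_decr_quantile assms, symmetric, unfolded distr_decr_quantile]
          integrable_distr_eq[OF meas assms]])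
  show "(LINT t|lebesgue_on {0..L}. \<phi> (decr_quantile L g t)) = (LINT x|lebesgue_on {0..L}. \<phi> (g x))"
    by (rule trans[OF integral_distr[OF measurable_decr_quantile assms, symmetric, unfolded distr_decr_quantile]
          integral_distr[OF meas assms]])
qed

end

lemma decr_rearr_eq_decr_quantile:
  assumes "g \<in> borel_measurable (lebesgue_on {0..L})" "0 < t" "t < L"
  shows "decr_rearr {0..L} g t = ereal (decr_quantile L g t)"
proof -
  have "0 < L" "t \<noteq> 0" "t \<noteq> measure lebesgue {0..L}" using assms(2,3) by simp_all
  then show ?thesis
    unfolding decr_rearr_def decr_quantile_def if_not_P[OF \<open>t \<noteq> 0\<close>]
      if_not_P[OF \<open>t \<noteq> measure lebesgue {0..L}\<close>]
    by (intro ereal_Inf'[symmetric] less_decr_quantile_iff(2,3) assms)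
qed

section \<open>The bathtub principle\<close>

text \<open>The bathtub principle: among all weights \<open>0 \<le> \<eta> \<le> 1\<close> of total mass \<open>\<tau>\<close>, the integral of \<open>f \<eta>\<close> is
largest when the mass sits where \<open>f\<close> is largest. With \<open>s\<close> the value of the rearrangement at \<open>\<tau>\<close>,
pointwise \<open>f \<eta> \<le> (f - s)\<^sup>+ + s \<eta>\<close>, and the integral of \<open>(f - s)\<^sup>+\<close> can be read off from the
rearrangement, which exceeds \<open>s\<close> before \<open>\<tau>\<close> and is below \<open>s\<close> after it.\<close>

lemma bathtub:
  fixes f \<eta> :: "real \<Rightarrow> real"
  assumes L: "0 < L" and f: "integrable (lebesgue_on {0..L}) f"
    and \<eta>: "\<eta> \<in> borel_measurable (lebesgue_on {0..L})"
      "\<And>x. x \<in> {0..L} \<Longrightarrow> 0 \<le> \<eta> x \<and> \<eta> x \<le> 1"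
    and \<tau>: "(LINT x|lebesgue_on {0..L}. \<eta> x) = \<tau>" "0 < \<tau>" "\<tau> < L"
  shows "(LINT x|lebesgue_on {0..L}. f x * \<eta> x) \<le> (LINT t|lebesgue_on {0..\<tau>}. decr_quantile L f t)"
proof -
  let ?M = "lebesgue_on {0..L}" and ?q = "decr_quantile L f"
  define s where "s = ?q \<tau>"
  have fm: "f \<in> borel_measurable ?M" using f by simp
  note one = integrable_const_on_Icc[of 0 L]
  have q: "integrable ?M ?q"
    using integrable_decr_quantile_iff[OF L fm, of "\<lambda>x. x"] f by simp
  have \<eta>i: "integrable ?M \<eta>"
    using integrable_mult_bounded_on_Icc[OF one \<eta>(1), of 1 1] \<eta>(2) by simp
  have f\<eta>: "integrable ?M (\<lambda>x. f x * \<eta> x)"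
    using integrable_mult_bounded_on_Icc[OF f \<eta>(1), of 1] \<eta>(2) by simp
  have pos: "integrable ?M (\<lambda>x. max (f x - s) 0)"
    using f one by (intro integrable_max Bochner_Integration.integrable_diff) auto
  have "(LINT x|?M. f x * \<eta> x) \<le> (LINT x|?M. max (f x - s) 0 + s * \<eta> x)"
  proof (rule integral_mono[OF f\<eta>])
    show "integrable ?M (\<lambda>x. max (f x - s) 0 + s * \<eta> x)" using pos \<eta>i by simp
    fix x assume "x \<in> space ?M"
    then have "0 \<le> \<eta> x" "\<eta> x \<le> 1" using \<eta>(2)[of x] by auto
    then have "(f x - s) * \<eta> x \<le> max (f x - s) 0"
      by (cases "s \<le> f x") (auto simp: mult_left_le mult_le_0_iff max_def)
    then show "f x * \<eta> x \<le> max (f x - s) 0 + s * \<eta> x" by (simp add: algebra_simps)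
  qed
  also have "\<dots> = (LINT x|?M. max (f x - s) 0) + s * \<tau>"
    using pos \<eta>i \<tau>(1) by simp
  also have "(LINT x|?M. max (f x - s) 0) = (LINT t|?M. max (?q t - s) 0)"
    using integral_decr_quantile[OF L fm, of "\<lambda>y. max (y - s) 0"] by simp
  also have "\<dots> = (LINT t|?M. indicator {0..\<tau>} t * (?q t - s))"
  proof (rule integral_cong_AE)
    have [measurable]: "?q \<in> borel_measurable ?M" using q by simp
    have [measurable]: "{0..\<tau>} \<in> sets ?M" using \<tau> by (auto simp: sets_restrict_space_iff)
    show "(\<lambda>t. max (?q t - s) 0) \<in> borel_measurable ?M" by measurable
    show "(\<lambda>t. indicator {0..\<tau>} t * (?q t - s)) \<in> borel_measurable ?M" by measurable
    show "AE t in ?M. max (?q t - s) 0 = indicator {0..\<tau>} t * (?q t - s)"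
      using AE_Icc_interior[of 0 L]
    proof eventually_elim
      case (elim t)
      then have "t \<le> \<tau> \<Longrightarrow> s \<le> ?q t" "\<tau> < t \<Longrightarrow> ?q t \<le> s"
        using decr_quantile_antimono[OF L fm, of t \<tau>] decr_quantile_antimono[OF L fm, of \<tau> t] \<tau>(2,3)
        by (auto simp: s_def)
      then show ?case using elim by (cases "t \<le> \<tau>") (simp_all add: max_def)
    qed
  qed
  also have "\<dots> = (LINT t|lebesgue_on {0..\<tau>}. ?q t - s)"
  proof -
    have "lebesgue_on {0..\<tau>} = restrict_space ?M {0..\<tau>}"
    proof -
      have "{0..L} \<inter> {0..\<tau>} = {0..\<tau>}" using \<tau>(3) by auto
      moreover have "restrict_space ?M {0..\<tau>} = lebesgue_on ({0..L} \<inter> {0..\<tau>})"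
        by (rule restrict_restrict_space) simp_all
      ultimately show ?thesis by (simp only:)
    qed
    moreover have "{0..\<tau>} \<inter> space ?M \<in> sets ?M" using \<tau> by (auto simp: sets_restrict_space_iff)
    ultimately show ?thesis by (simp only: integral_restrict_space real_scaleR_def)
  qed
  also have "\<dots> = (LINT t|lebesgue_on {0..\<tau>}. ?q t) - s * \<tau>"
  proof -
    have "integrable (lebesgue_on {0..\<tau>}) ?q"
      by (rule integrable_subinterval[OF q]) (use \<tau> in auto)
    then show ?thesis
      using integrable_const_on_Icc[of 0 \<tau> s] \<tau> by (simp add: measure_restrict_space)
  qed
  finally show ?thesis by simp
qed

text \<open>The constant weight \<open>\<tau> / L\<close> is one of the competitors, and it gives \<open>0\<close> for \<open>f\<close> of zero mean.\<close>

lemma quantile_integral_nonneg: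
  assumes L: "0 < L" and f: "integrable (lebesgue_on {0..L}) f"
    and mean: "(LINT x|lebesgue_on {0..L}. f x) = 0" and \<tau>: "0 < \<tau>" "\<tau> < L"
  shows "0 \<le> (LINT t|lebesgue_on {0..\<tau>}. decr_quantile L f t)"
proof -
  have "(LINT x|lebesgue_on {0..L}. f x * (\<tau> / L)) \<le> (LINT t|lebesgue_on {0..\<tau>}. decr_quantile L f t)"
    by (rule bathtub[OF L f]) (use \<tau> in \<open>auto simp: measure_restrict_space\<close>)
  then show ?thesis using mean by simp
qed

section \<open>Truncation\<close>

definition truncate :: "real \<Rightarrow> real \<Rightarrow> real \<Rightarrow> real" where
  "truncate c d y = max c (min d y)"

lemma truncate_lipschitz: "\<bar>truncate c d y - truncate c d z\<bar> \<le> \<bar>y - z\<bar>"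
proof -
  have "\<bar>max c p - max c q\<bar> \<le> \<bar>p - q\<bar>" "\<bar>min d p - min d q\<bar> \<le> \<bar>p - q\<bar>" for p q :: real
    by (auto simp: max_def min_def)
  then show ?thesis unfolding truncate_def using order_trans by blast
qed

text \<open>Where the derivative does not vanish, a level set is locally a single point. So the corners that
truncation creates at the two cut-off levels form a null set.\<close>

lemma negligible_noncritical_level_set:
  fixes u u' :: "real \<Rightarrow> real"
  assumes "\<And>x. x \<in> S \<Longrightarrow> (u has_real_derivative u' x) (at x within S)"
  shows "negligible {x \<in> S. u x = c \<and> u' x \<noteq> 0}" (is "negligible ?Z")
proof (rule iffD2[OF locally_negligible_alt], rule ballI)
  fix x assume x: "x \<in> ?Z"
  then have "x \<in> S" "u' x \<noteq> 0" "u x = c" by auto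
  have "((\<lambda>y. (u y - u x) / (y - x)) \<longlongrightarrow> u' x) (at x within S)"
    using assms[OF \<open>x \<in> S\<close>] unfolding has_field_derivative_iff .
  from this \<open>u' x \<noteq> 0\<close> have "\<forall>\<^sub>F y in at x within S. (u y - u x) / (y - x) \<noteq> 0"
    by (rule tendsto_imp_eventually_ne)
  then obtain T where T: "open T" "x \<in> T" "\<And>y. y \<in> T \<Longrightarrow> y \<noteq> x \<Longrightarrow> y \<in> S \<Longrightarrow> u y \<noteq> u x"
    unfolding eventually_at_topological by (metis diff_self divide_eq_0_iff)
  have "y = x" if "y \<in> ?Z \<inter> T" for y
    using that T(3)[of y] \<open>u x = c\<close> by auto
  then have "?Z \<inter> T = {x}" using x T(2) by blast
  then have "openin (top_of_set ?Z) {x}" using T(1) openin_open_Int[of T ?Z] by simp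
  then show "\<exists>U. openin (top_of_set ?Z) U \<and> x \<in> U \<and> negligible U"
    using negligible_sing by blast
qed

text \<open>At a point where \<open>u\<close> equals a cut-off level but has zero derivative, the truncation still has
derivative zero, because its difference quotients are dominated by those of \<open>u\<close>.\<close>

lemma has_real_derivative_truncate:
  fixes u :: "real \<Rightarrow> real"
  assumes "(u has_real_derivative D) (at x within S)" and "c < d"
    and crit: "u x = c \<or> u x = d \<Longrightarrow> D = 0"
  shows "((\<lambda>x. truncate c d (u x)) has_real_derivative (if c < u x \<and> u x < d then D else 0))
           (at x within S)"
proof -
  have cont: "(u \<longlongrightarrow> u x) (at x within S)"
    using assms(1) DERIV_continuous continuous_within by blast
  have lim: "((\<lambda>y. (u y - u x) / (y - x)) \<longlongrightarrow> D) (at x within S)"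
    using assms(1) by (simp add: has_field_derivative_iff)
  consider "u x < c" | "d < u x" | "c < u x" "u x < d" | "u x = c \<or> u x = d" by linarith
  then have "((\<lambda>y. (truncate c d (u y) - truncate c d (u x)) / (y - x))
      \<longlongrightarrow> (if c < u x \<and> u x < d then D else 0)) (at x within S)"
  proof cases
    case 1
    have "\<forall>\<^sub>F y in at x within S. u y < c" using cont 1 by (rule order_tendstoD)
    then have "\<forall>\<^sub>F y in at x within S. 0 = (truncate c d (u y) - truncate c d (u x)) / (y - x)"
      by eventually_elim (use 1 \<open>c < d\<close> in \<open>simp add: truncate_def\<close>)
    from Lim_transform_eventually[OF tendsto_const this] show ?thesis using 1 by simp
  next
    case 2
    have "\<forall>\<^sub>F y in at x within S. d < u y" using cont 2 by (rule order_tendstoD)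
    then have "\<forall>\<^sub>F y in at x within S. 0 = (truncate c d (u y) - truncate c d (u x)) / (y - x)"
      by eventually_elim (use 2 \<open>c < d\<close> in \<open>simp add: truncate_def\<close>)
    from Lim_transform_eventually[OF tendsto_const this] show ?thesis using 2 by simp
  next
    case 3
    have "\<forall>\<^sub>F y in at x within S. c < u y" "\<forall>\<^sub>F y in at x within S. u y < d"
      using order_tendstoD[OF cont] 3 by blast+
    then have "\<forall>\<^sub>F y in at x within S.
        (u y - u x) / (y - x) = (truncate c d (u y) - truncate c d (u x)) / (y - x)"
      by eventually_elim (use 3 in \<open>simp add: truncate_def\<close>)
    from Lim_transform_eventually[OF lim this] show ?thesis using 3 by simp
  next
    case 4
    have "((\<lambda>y. (u y - u x) / (y - x)) \<longlongrightarrow> 0) (at x within S)" using lim crit[OF 4] by simp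
    then have "((\<lambda>y. (truncate c d (u y) - truncate c d (u x)) / (y - x)) \<longlongrightarrow> 0) (at x within S)"
      by (rule tendsto_0_le[where K = 1])
         (simp add: always_eventually truncate_lipschitz divide_right_mono)
    then show ?thesis using 4 by auto
  qed
  then show ?thesis by (simp add: has_field_derivative_iff)
qed

lemma truncate_bounds: "c < d \<Longrightarrow> c \<le> truncate c d y \<and> truncate c d y \<le> d"
  by (auto simp: truncate_def)

section \<open>Level bands of a Neumann solution\<close>

text \<open>Throughout this part \<open>u\<close> solves \<open>- u'' = f\<close> on \<open>{0..L}\<close> with Neumann boundary conditions and
derivative \<open>u'\<close>. The set where \<open>c < u < d\<close> is called a band.\<close>

context
  fixes L :: real and u u' f :: "real \<Rightarrow> real"
  assumes L: "0 < L"
    and du: "\<And>x. x \<in> {0..L} \<Longrightarrow> (u has_real_derivative u' x) (at x within {0..L})"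
    and cu': "continuous_on {0..L} u'"
    and ac: "abs_continuous_on_interval 0 L u'"
    and ode: "AE x in lebesgue_on {0<..<L}. (u' has_real_derivative - f x) (at x)"
    and bc: "u' 0 = 0" "u' L = 0"
    and f: "integrable (lebesgue_on {0..L}) f"
begin

text \<open>The derivative of the truncation of \<open>u\<close> to the range from \<open>c\<close> to \<open>d\<close>, valid almost everywhere.\<close>

definition "band_deriv c d x = (if c < u x \<and> u x < d then u' x else 0)"

lemma continuous_solution: "continuous_on {0..L} u"
  unfolding continuous_on_eq_continuous_within using du DERIV_continuous by (intro ballI) blast

lemma measurable_solution: "u \<in> borel_measurable (lebesgue_on {0..L})"
  by (rule continuous_imp_measurable_on_sets_lebesgue[OF continuous_solution]) simp

lemma measurable_solution_deriv: "u' \<in> borel_measurable (lebesgue_on {0..L})"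
  by (rule continuous_imp_measurable_on_sets_lebesgue[OF cu']) simp

lemma solution_deriv_bounded: obtains B where "B > 0" "\<And>x. x \<in> {0..L} \<Longrightarrow> \<bar>u' x\<bar> \<le> B"
proof -
  have "bounded (u' ` {0..L})"
    using compact_continuous_image[OF cu'] compact_imp_bounded by blast
  then show thesis using that unfolding bounded_pos by (auto simp: real_norm_def)
qed

lemma solution_lipschitz:
  assumes B: "\<And>x. x \<in> {0..L} \<Longrightarrow> \<bar>u' x\<bar> \<le> B" and "x \<in> {0..L}" "y \<in> {0..L}"
  shows "\<bar>u x - u y\<bar> \<le> B * \<bar>x - y\<bar>"
  using field_differentiable_bound[of "{0..L}" u u' B y x] du assms
  by (simp add: real_norm_def abs_minus_commute)

lemma measurable_band_deriv: "(\<lambda>x. band_deriv c d x) \<in> borel_measurable (lebesgue_on {0..L})"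
proof -
  note [measurable] = measurable_solution measurable_solution_deriv
  show ?thesis unfolding band_deriv_def by measurable
qed

lemma integrable_band_deriv: "integrable (lebesgue_on {0..L}) (\<lambda>x. band_deriv c d x)"
proof -
  obtain B where B: "B > 0" "\<And>x. x \<in> {0..L} \<Longrightarrow> \<bar>u' x\<bar> \<le> B" using solution_deriv_bounded by blast
  have "integrable (lebesgue_on {0..L}) (\<lambda>x. 1 * band_deriv c d x)"
    by (rule integrable_mult_bounded_on_Icc[OF integrable_const_on_Icc measurable_band_deriv, where B = B])
       (use B in \<open>auto simp: band_deriv_def\<close>)
  then show ?thesis by simp
qed

lemma integrable_band_deriv_mult: "integrable (lebesgue_on {0..L}) (\<lambda>x. band_deriv c d x * u' x)"
proof -
  obtain B where B: "B > 0" "\<And>x. x \<in> {0..L} \<Longrightarrow> \<bar>u' x\<bar> \<le> B" using solution_deriv_bounded by blast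
  show ?thesis by (rule integrable_mult_bounded_on_Icc[OF integrable_band_deriv measurable_solution_deriv B(2)])
qed

lemma has_real_derivative_truncated_solution:
  assumes "c < d"
  obtains N where "negligible N"
    "\<And>x. x \<in> {0..L} - N \<Longrightarrow>
       ((\<lambda>x. truncate c d (u x)) has_real_derivative band_deriv c d x) (at x within {0..L})"
proof -
  let ?N = "{x \<in> {0..L}. u x = c \<and> u' x \<noteq> 0} \<union> {x \<in> {0..L}. u x = d \<and> u' x \<noteq> 0}"
  have "negligible ?N" using negligible_noncritical_level_set[OF du] by simp
  moreover have "((\<lambda>x. truncate c d (u x)) has_real_derivative band_deriv c d x) (at x within {0..L})"
    if "x \<in> {0..L} - ?N" for x
    unfolding band_deriv_def using that by (intro has_real_derivative_truncate du \<open>c < d\<close>) auto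
  ultimately show thesis by (rule that)
qed

lemma truncated_solution_lipschitz:
  assumes "\<And>x. x \<in> {0..L} \<Longrightarrow> \<bar>u' x\<bar> \<le> B" "x \<in> {0..L}" "y \<in> {0..L}"
  shows "\<bar>truncate c d (u x) - truncate c d (u y)\<bar> \<le> B * \<bar>x - y\<bar>"
  using truncate_lipschitz[of c d "u x" "u y"] solution_lipschitz[OF assms] by linarith

lemma measurable_truncated_solution: "(\<lambda>x. truncate c d (u x)) \<in> borel_measurable (lebesgue_on {0..L})"
  unfolding truncate_def using measurable_solution by (intro borel_measurable_max borel_measurable_min) auto

text \<open>The weak form of the equation, tested with the truncation of \<open>u\<close> minus \<open>c\<close>. The boundary terms
drop out because \<open>u'\<close> vanishes at both ends.\<close>

lemma dirichlet_energy_of_band: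
  assumes "c < d"
  shows "(LINT x|lebesgue_on {0..L}. band_deriv c d x * u' x) = (LINT x|lebesgue_on {0..L}. f x * (truncate c d (u x) - c))"
proof -
  define T where "T x = truncate c d (u x) - c" for x
  obtain B where B: "B > 0" "\<And>x. x \<in> {0..L} \<Longrightarrow> \<bar>u' x\<bar> \<le> B" using solution_deriv_bounded by blast
  obtain N1 where N1: "negligible N1"
    "\<And>x. x \<in> {0..L} - N1 \<Longrightarrow>
       ((\<lambda>x. truncate c d (u x)) has_real_derivative band_deriv c d x) (at x within {0..L})"
    using has_real_derivative_truncated_solution[OF assms] by blast
  obtain N2 where N2: "negligible N2"
    "\<And>x. x \<in> {0<..<L} - N2 \<Longrightarrow> (u' has_real_derivative - f x) (at x)"
    using AE_lebesgue_onE[OF ode] by auto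
  define N where "N = N1 \<union> N2 \<union> {0, L}"
  have "negligible N" using N1(1) N2(1) by (simp add: N_def)
  have T: "\<bar>T x\<bar> \<le> d - c" for x
    using truncate_bounds[OF assms, of "u x"] by (auto simp: T_def)
  \<comment> \<open>Integration by parts is the fundamental theorem for the product of \<open>u'\<close> and \<open>T\<close>.\<close>
  have "abs_continuous_on_interval 0 L (\<lambda>x. u' x * T x)"
  proof (rule abs_continuous_mult_lipschitz[OF ac B(2) T])
    show "\<bar>T x - T y\<bar> \<le> B * \<bar>x - y\<bar>" if "x \<in> {0..L}" "y \<in> {0..L}" for x y
      using truncated_solution_lipschitz[OF B(2) that] by (simp add: T_def)
  qed
  then have "((\<lambda>x. - f x * T x + band_deriv c d x * u' x) has_integral u' L * T L - u' 0 * T 0) {0..L}"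
  proof (rule abs_continuous_ftc[OF _ less_imp_le[OF L] \<open>negligible N\<close>])
    fix x assume "x \<in> {0..L} - N"
    then have x: "x \<in> {0..L} - N1" "x \<in> {0<..<L} - N2" by (auto simp: N_def)
    have "(T has_real_derivative band_deriv c d x) (at x within {0..L})"
      using DERIV_diff[OF N1(2)[OF x(1)] DERIV_const[of c]] unfolding T_def[abs_def] by simp
    moreover have "(u' has_real_derivative - f x) (at x within {0..L})"
      using N2(2)[OF x(2)] by (rule has_field_derivative_at_within)
    ultimately show "((\<lambda>x. u' x * T x) has_real_derivative - f x * T x + band_deriv c d x * u' x) (at x within {0..L})"
      by (rule DERIV_mult[rotated])
  qed
  then have I: "((\<lambda>x. - f x * T x + band_deriv c d x * u' x) has_integral 0) {0..L}"
    using bc by simp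
  have "T \<in> borel_measurable (lebesgue_on {0..L})"
    unfolding T_def[abs_def] using measurable_truncated_solution by (intro borel_measurable_diff) auto
  then have fT: "integrable (lebesgue_on {0..L}) (\<lambda>x. f x * T x)"
    using integrable_mult_bounded_on_Icc[OF f, of T] T by blast
  then have "integrable (lebesgue_on {0..L}) (\<lambda>x. - f x * T x + band_deriv c d x * u' x)"
    using integrable_band_deriv_mult[of c d] by simp
  from has_integral_integral_lebesgue_on[OF this] have
    "(LINT x|lebesgue_on {0..L}. - f x * T x + band_deriv c d x * u' x) = 0"
    using I by (auto intro: has_integral_unique)
  then show ?thesis using fT integrable_band_deriv_mult[of c d] by (simp add: T_def)
qed

text \<open>Applied to \<open>v\<close>, this identifies \<open>- v'\<close> with the integrals of the rearranged data that appear in the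
bathtub bound.\<close>

lemma derivative_eq_minus_integral:
  assumes "\<tau> \<in> {0..L}"
  shows "u' \<tau> = - (LINT x|lebesgue_on {0..\<tau>}. f x)"
proof -
  obtain N where N: "negligible N"
    "\<And>x. x \<in> {0<..<L} - N \<Longrightarrow> (u' has_real_derivative - f x) (at x)"
    using AE_lebesgue_onE[OF ode] by auto
  have "((\<lambda>x. - f x) has_integral u' \<tau> - u' 0) {0..\<tau>}"
  proof (rule abs_continuous_ftc[of _ _ _ "N \<union> {0, L}"])
    show "abs_continuous_on_interval 0 \<tau> u'"
      using abs_continuous_subinterval[OF ac] assms by simp
    show "(u' has_real_derivative - f x) (at x within {0..\<tau>})" if "x \<in> {0..\<tau>} - (N \<union> {0, L})" for x
    proof (rule has_field_derivative_at_within, rule N(2))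
      show "x \<in> {0<..<L} - N" using that assms by auto
    qed
  qed (use assms N(1) in auto)
  moreover have "((\<lambda>x. - f x) has_integral - (LINT x|lebesgue_on {0..\<tau>}. f x)) {0..\<tau>}"
    using integrable_subinterval[OF f, of 0 \<tau>] assms
    by (intro has_integral_neg has_integral_integral_lebesgue_on) auto
  ultimately have "u' \<tau> - u' 0 = - (LINT x|lebesgue_on {0..\<tau>}. f x)" by (rule has_integral_unique)
  then show ?thesis using bc(1) by simp
qed

text \<open>Between a point where \<open>u\<close> is at most \<open>c\<close> and a point where it is at least \<open>d\<close>, the function has to
cross the whole band. This is where dimension one enters, and where the bound is independent of how
often the band is crossed.\<close>

lemma gap_le_variation_on_band:
  assumes "c < d" "x1 \<in> {0..L}" "x2 \<in> {0..L}" "u x1 \<le> c" "d \<le> u x2"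
  shows "d - c \<le> (LINT x|lebesgue_on {0..L}. \<bar>band_deriv c d x\<bar>)"
proof -
  define a b where "a = min x1 x2" and "b = max x1 x2"
  have ab: "0 \<le> a" "a \<le> b" "b \<le> L" "{a..b} \<subseteq> {0..L}" using assms by (auto simp: a_def b_def)
  obtain B where B: "B > 0" "\<And>x. x \<in> {0..L} \<Longrightarrow> \<bar>u' x\<bar> \<le> B" using solution_deriv_bounded by blast
  obtain N where N: "negligible N"
    "\<And>x. x \<in> {0..L} - N \<Longrightarrow>
       ((\<lambda>x. truncate c d (u x)) has_real_derivative band_deriv c d x) (at x within {0..L})"
    using has_real_derivative_truncated_solution[OF assms(1)] by blast
  have "abs_continuous_on_interval 0 L (\<lambda>x. 1 * truncate c d (u x))"
  proof (rule abs_continuous_mult_lipschitz[OF abs_continuous_const])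
    show "\<bar>truncate c d (u x)\<bar> \<le> \<bar>c\<bar> + \<bar>d\<bar>" for x
      using truncate_bounds[OF assms(1), of "u x"] by linarith
  qed (use truncated_solution_lipschitz[OF B(2)] in auto)
  then have "abs_continuous_on_interval a b (\<lambda>x. truncate c d (u x))"
    using abs_continuous_subinterval ab by simp
  then have I: "((\<lambda>x. band_deriv c d x) has_integral truncate c d (u b) - truncate c d (u a)) {a..b}"
  proof (rule abs_continuous_ftc[OF _ ab(2) N(1)])
    fix x assume "x \<in> {a..b} - N"
    then show "((\<lambda>x. truncate c d (u x)) has_real_derivative band_deriv c d x) (at x within {a..b})"
      using N(2)[of x] ab has_field_derivative_subset[OF _ ab(4)] by blast
  qed
  have "d - c = \<bar>truncate c d (u b) - truncate c d (u a)\<bar>"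
    using assms by (cases "x1 \<le> x2") (auto simp: a_def b_def truncate_def max_def min_def)
  also have "\<dots> = norm (integral {a..b} (\<lambda>x. band_deriv c d x))"
    using integral_unique[OF I] by simp
  also have "\<dots> \<le> integral {a..b} (\<lambda>x. \<bar>band_deriv c d x\<bar>)"
  proof (rule integral_norm_bound_integral)
    show "(\<lambda>x. band_deriv c d x) integrable_on {a..b}" using I by blast
    have "integrable (lebesgue_on {a..b}) (\<lambda>x. \<bar>band_deriv c d x\<bar>)"
      by (rule integrable_subinterval[OF integrable_abs[OF integrable_band_deriv]]) (use ab in auto)
    then show "(\<lambda>x. \<bar>band_deriv c d x\<bar>) integrable_on {a..b}"
      by (rule integrable_on_lebesgue_on) simp
  qed simp
  also have "\<dots> \<le> integral {0..L} (\<lambda>x. \<bar>band_deriv c d x\<bar>)"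
  proof (rule integral_subset_le[OF ab(4)])
    have "integrable (lebesgue_on {a..b}) (\<lambda>x. \<bar>band_deriv c d x\<bar>)"
      by (rule integrable_subinterval[OF integrable_abs[OF integrable_band_deriv]]) (use ab in auto)
    then show "(\<lambda>x. \<bar>band_deriv c d x\<bar>) integrable_on {a..b}"
      by (rule integrable_on_lebesgue_on) simp
    show "(\<lambda>x. \<bar>band_deriv c d x\<bar>) integrable_on {0..L}"
      by (rule integrable_on_lebesgue_on[OF integrable_abs[OF integrable_band_deriv]]) simp
  qed simp
  also have "\<dots> = (LINT x|lebesgue_on {0..L}. \<bar>band_deriv c d x\<bar>)"
    by (rule lebesgue_integral_eq_integral[symmetric, OF integrable_abs[OF integrable_band_deriv]]) simp
  finally show ?thesis .
qed

text \<open>The bounds \<open>dirichlet_energy_of_band\<close> and \<open>gap_le_variation_on_band\<close> are combined through \<open>\<bar>p\<bar> \<le> p\<^sup>2 / (2 * K) + K / 2\<close> on the band. The weight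
multiplying \<open>f\<close> is the truncation rescaled to take values between 0 and 1. The energy is \<open>d - c\<close>
times the integral of \<open>f\<close> against this weight, so half of \<open>d - c\<close> is absorbed on the left.\<close>

lemma gap_le_band_measure:
  assumes "c < d" "x1 \<in> {0..L}" "x2 \<in> {0..L}" "u x1 \<le> c" "d \<le> u x2"
    and K: "(LINT x|lebesgue_on {0..L}. f x * ((truncate c d (u x) - c) / (d - c))) < K"
  shows "d - c \<le> K * measure lebesgue {x \<in> {0..L}. c < u x \<and> u x < d}"
proof -
  define A where "A = {x \<in> {0..L}. c < u x \<and> u x < d}"
  define E where "E = (LINT x|lebesgue_on {0..L}. band_deriv c d x * u' x)"
  define F where "F = (LINT x|lebesgue_on {0..L}. f x * ((truncate c d (u x) - c) / (d - c)))"
  have "E = (LINT x|lebesgue_on {0..L}. (d - c) * (f x * ((truncate c d (u x) - c) / (d - c))))"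
    unfolding E_def dirichlet_energy_of_band[OF assms(1)]
    using assms(1) by (intro Bochner_Integration.integral_cong) auto
  then have E: "E = (d - c) * F" by (simp add: F_def)
  have "E \<ge> 0" unfolding E_def band_deriv_def by (intro Bochner_Integration.integral_nonneg) simp
  then have "F \<ge> 0" using E assms(1) by (simp add: zero_le_mult_iff)
  then have "K > 0" using K by (simp add: F_def)
  have "{x \<in> space (lebesgue_on {0..L}). c < u x \<and> u x < d} \<in> sets (lebesgue_on {0..L})"
  proof -
    note [measurable] = measurable_solution
    show ?thesis by measurable
  qed
  then have A: "A \<in> sets (lebesgue_on {0..L})" by (simp add: A_def)
  note iA = integrable_indicator_on_Icc[OF A]
  note mA = integral_indicator_on_Icc[OF A]
  have "d - c \<le> (LINT x|lebesgue_on {0..L}. \<bar>band_deriv c d x\<bar>)"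
    by (rule gap_le_variation_on_band[OF assms(1-5)])
  also have "\<dots> \<le> (LINT x|lebesgue_on {0..L}. (1 / (2 * K)) * (band_deriv c d x * u' x) + (K / 2) * indicat_real A x)"
  proof (rule integral_mono)
    show "integrable (lebesgue_on {0..L}) (\<lambda>x. \<bar>band_deriv c d x\<bar>)" by (rule integrable_abs[OF integrable_band_deriv])
    show "integrable (lebesgue_on {0..L}) (\<lambda>x. (1 / (2 * K)) * (band_deriv c d x * u' x) + (K / 2) * indicat_real A x)"
      by (intro Bochner_Integration.integrable_add integrable_mult_right integrable_band_deriv_mult iA)
    fix x assume "x \<in> space (lebesgue_on {0..L})"
    \<comment> \<open>The pointwise inequality is only used on the band; outside it both sides vanish.\<close>
    have "0 \<le> (\<bar>u' x\<bar> - K)\<^sup>2" by simp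
    then have "2 * K * \<bar>u' x\<bar> \<le> u' x * u' x + K * K"
      by (simp add: power2_eq_square algebra_simps abs_mult_self_eq)
    then have "\<bar>u' x\<bar> \<le> (1 / (2 * K)) * (u' x * u' x) + K / 2"
      using \<open>K > 0\<close> by (simp add: field_simps)
    then show "\<bar>band_deriv c d x\<bar> \<le> (1 / (2 * K)) * (band_deriv c d x * u' x) + (K / 2) * indicat_real A x"
      using \<open>x \<in> space (lebesgue_on {0..L})\<close> by (simp add: A_def band_deriv_def)
  qed
  also have "\<dots> = (1 / (2 * K)) * E + (K / 2) * measure lebesgue A"
    using integrable_band_deriv_mult[of c d] iA mA by (simp add: E_def)
  also have "(1 / (2 * K)) * E \<le> (d - c) / 2"
  proof -
    have "F \<le> K" using K by (simp add: F_def)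
    then have "E \<le> (d - c) * K" unfolding E using assms(1) by (intro mult_left_mono) auto
    then have "(1 / (2 * K)) * E \<le> (1 / (2 * K)) * ((d - c) * K)"
      using \<open>K > 0\<close> by (intro mult_left_mono) auto
    also have "\<dots> = (d - c) / 2" using \<open>K > 0\<close> by simp
    finally show ?thesis .
  qed
  finally have "d - c \<le> (d - c) / 2 + (K / 2) * measure lebesgue A" by simp
  moreover have "y \<le> y / 2 + K / 2 * z \<Longrightarrow> y \<le> K * z" for y z :: real by simp
  ultimately have "d - c \<le> K * measure lebesgue A" by blast
  then show ?thesis unfolding A_def .
qed

text \<open>The differential inequality \<open>- r' \<le> G\<close> in integrated form, where \<open>r\<close> is the rearrangement of \<open>u\<close>
and \<open>G \<tau>\<close> the integral of the rearrangement of \<open>f\<close> from \<open>0\<close> to \<open>\<tau>\<close>. Take the band between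
\<open>c = r t2\<close> and an arbitrary level \<open>d\<close> below \<open>r t1\<close>. Its measure is at most \<open>t2 - t1\<close>, and the mass \<open>\<tau>\<close>
of the weight \<open>\<eta>\<close> lies between \<open>|{d < u}| > t1\<close> and \<open>|{c < u}| \<le> t2\<close>, so the bathtub principle
bounds the integral of \<open>f \<eta>\<close> by \<open>G \<tau>\<close>.\<close>

lemma quantile_increment_le:
  assumes t: "0 < t1" "t1 < t2" "t2 < L" and "0 < K"
    and G: "\<And>\<tau>. \<tau> \<in> {t1..t2} \<Longrightarrow> (LINT t|lebesgue_on {0..\<tau>}. decr_quantile L f t) < K"
  shows "decr_quantile L u t1 - decr_quantile L u t2 \<le> K * (t2 - t1)"
proof (cases "decr_quantile L u t1 \<le> decr_quantile L u t2")
  case True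
  then show ?thesis using t mult_pos_pos[of K "t2 - t1"] \<open>0 < K\<close> by linarith
next
  case False
  define c where "c = decr_quantile L u t2"
  note iff = less_decr_quantile_iff(1)[OF L measurable_solution]
  have "decr_quantile L u t1 \<le> c + K * (t2 - t1)"
  \<comment> \<open>Staying strictly below \<open>r t1\<close> avoids the measure of the level set at \<open>r t1\<close> itself.\<close>
  proof (rule dense_le_bounded)
    show "c < decr_quantile L u t1" using False by (simp add: c_def)
    fix d assume d: "c < d" "d < decr_quantile L u t1"
    let ?c = "{x \<in> {0..L}. c < u x}" and ?d = "{x \<in> {0..L}. d < u x}"
      and ?A = "{x \<in> {0..L}. c < u x \<and> u x < d}"
    have mc: "measure lebesgue ?c \<le> t2" using iff[of t2 c] t by (simp add: c_def)
    have md: "t1 < measure lebesgue ?d" using iff[of t1 d] t d(2) by simp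
    have cm: "?c \<in> lmeasurable" and dm: "?d \<in> lmeasurable"
      using superlevel_lmeasurable[OF measurable_solution] by blast+
    have Am: "?A \<in> lmeasurable"
    proof -
      note [measurable] = measurable_solution
      have "{x \<in> space (lebesgue_on {0..L}). c < u x \<and> u x < d} \<in> sets (lebesgue_on {0..L})" by measurable
      then have "?A \<in> sets lebesgue" by (simp add: sets_restrict_space_iff)
      then show ?thesis using cm by (rule fmeasurableI2[rotated, rotated]) auto
    qed
    obtain x2 where x2: "x2 \<in> {0..L}" "d < u x2"
    proof -
      have "?d \<noteq> {}"
      proof
        assume "?d = {}"
        then have "measure lebesgue ?d = 0" by (simp only: measure_empty)
        then show False using md t(1) by linarith
      qed
      then show thesis using that by blast
    qed
    have "\<exists>x1\<in>{0..L}. u x1 \<le> c"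
    proof (rule ccontr)
      assume "\<not> ?thesis"
      then have "?c = {0..L}" by force
      then have "measure lebesgue ?c = measure lebesgue {0..L}" by (simp only:)
      then show False using mc t L by simp
    qed
    then obtain x1 where x1: "x1 \<in> {0..L}" "u x1 \<le> c" by blast
    define \<eta> where "\<eta> x = (truncate c d (u x) - c) / (d - c)" for x
    have \<eta>_range: "0 \<le> \<eta> x" "\<eta> x \<le> 1" for x
      using truncate_bounds[OF d(1), of "u x"] d(1) by (auto simp: \<eta>_def)
    have \<eta>m: "\<eta> \<in> borel_measurable (lebesgue_on {0..L})"
      unfolding \<eta>_def[abs_def] using measurable_truncated_solution
      by (intro borel_measurable_divide borel_measurable_diff) auto
    have \<eta>i: "integrable (lebesgue_on {0..L}) \<eta>"
      using integrable_mult_bounded_on_Icc[OF integrable_const_on_Icc[of 0 L 1] \<eta>m, of 1] \<eta>_range by simp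
    have "?c \<in> sets (lebesgue_on {0..L})" "?d \<in> sets (lebesgue_on {0..L})"
      by (rule lmeasurable_imp_sets_lebesgue_on; use cm dm in blast)+
    note ic = this(1)[THEN integrable_indicator_on_Icc] this(1)[THEN integral_indicator_on_Icc]
      and id = this(2)[THEN integrable_indicator_on_Icc] this(2)[THEN integral_indicator_on_Icc]
    define \<tau> where "\<tau> = (LINT x|lebesgue_on {0..L}. \<eta> x)"
    have "\<tau> \<le> (LINT x|lebesgue_on {0..L}. indicat_real ?c x)"
      unfolding \<tau>_def
    proof (rule integral_mono[OF \<eta>i])
      show "integrable (lebesgue_on {0..L}) (indicat_real ?c)" by (rule ic(1))
      fix x assume "x \<in> space (lebesgue_on {0..L})"
      then show "\<eta> x \<le> indicat_real ?c x"
        using \<eta>_range[of x] d(1) by (auto simp: indicator_def \<eta>_def truncate_def)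
    qed
    then have \<tau>2: "\<tau> \<le> t2" using ic(2) mc by linarith
    have "(LINT x|lebesgue_on {0..L}. indicat_real ?d x) \<le> \<tau>"
      unfolding \<tau>_def
    proof (rule integral_mono[OF _ \<eta>i])
      show "integrable (lebesgue_on {0..L}) (indicat_real ?d)" by (rule id(1))
      fix x assume "x \<in> space (lebesgue_on {0..L})"
      then show "indicat_real ?d x \<le> \<eta> x"
        using \<eta>_range[of x] d(1) by (auto simp: indicator_def \<eta>_def truncate_def)
    qed
    then have \<tau>1: "t1 \<le> \<tau>" using id(2) md by linarith
    have "(LINT x|lebesgue_on {0..L}. f x * \<eta> x) \<le> (LINT t|lebesgue_on {0..\<tau>}. decr_quantile L f t)"
      by (rule bathtub[OF L f \<eta>m]) (use \<eta>_range \<tau>1 \<tau>2 t in \<open>auto simp: \<tau>_def\<close>)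
    also have "\<dots> < K" using \<tau>1 \<tau>2 by (intro G) simp
    finally have gap: "d - c \<le> K * measure lebesgue ?A"
      unfolding \<eta>_def by (intro gap_le_band_measure[OF d(1) x1(1) x2(1) x1(2)]) (use x2 in auto)
    have "measure lebesgue ?A + measure lebesgue ?d \<le> measure lebesgue ?c"
    proof -
      have "measure lebesgue ?A + measure lebesgue ?d = measure lebesgue (?A \<union> ?d)"
      proof (rule measure_Union[symmetric])
        show "emeasure lebesgue ?A \<noteq> \<infinity>" "emeasure lebesgue ?d \<noteq> \<infinity>"
          using fmeasurableD2[OF Am] fmeasurableD2[OF dm] by (simp_all only: infinity_ennreal_def not_False_eq_True)
        show "?A \<inter> ?d = {}" by force
      qed (intro fmeasurableD Am dm)+
      also have "\<dots> \<le> measure lebesgue ?c"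
        using d(1) by (intro measure_mono_fmeasurable[OF _ _ cm] sets.Un
            fmeasurableD[OF Am] fmeasurableD[OF dm]) force
      finally show ?thesis .
    qed
    then have "K * measure lebesgue ?A \<le> K * (t2 - t1)"
      using mc md \<open>0 < K\<close> by (intro mult_left_mono) linarith+
    with gap show "d \<le> c + K * (t2 - t1)" by linarith
  qed
  then show ?thesis by (simp add: c_def)
qed

end

section \<open>Comparing the rearranged solution with the solution for rearranged data\<close>

text \<open>A step size \<open>\<delta>\<close> that works uniformly lets local monotonicity be chained.\<close>

lemma antitone_if_locally_antitone:
  fixes h :: "real \<Rightarrow> real"
  assumes "\<delta> > 0" and loc: "\<And>s t. a < s \<Longrightarrow> s < t \<Longrightarrow> t < b \<Longrightarrow> t - s < \<delta> \<Longrightarrow> h t \<le> h s"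
    and "a < s" "s \<le> t" "t < b"
  shows "h t \<le> h s"
proof -
  have "h t \<le> h s" if "a < s" "s \<le> t" "t < b" "t - s \<le> of_nat n * (\<delta> / 2)" for n s t
    using that
  proof (induction n arbitrary: s)
    case 0
    then show ?case by simp
  next
    case (Suc n)
    define m where "m = min t (s + \<delta> / 2)"
    have "h t \<le> h m" by (rule Suc.IH) (use Suc.prems \<open>\<delta> > 0\<close> in \<open>auto simp: m_def algebra_simps min_def\<close>)
    also have "h m \<le> h s"
      by (cases "m = s") (use Suc.prems \<open>\<delta> > 0\<close> in \<open>auto simp: m_def intro!: loc\<close>)
    finally show ?case .
  qed
  moreover obtain n where "t - s \<le> of_nat n * (\<delta> / 2)"
    using reals_Archimedean3[of "\<delta> / 2"] \<open>\<delta> > 0\<close> by (metis half_gt_zero less_imp_le)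
  ultimately show ?thesis using assms(3-5) by blast
qed

text \<open>The core of the comparison. By the mean value theorem \<open>v\<close> decreases over a short interval at the
rate \<open>G \<xi>\<close> for some \<open>\<xi>\<close> in it, and by uniform continuity \<open>K = G \<xi> + \<epsilon>\<close> is an upper bound of \<open>G\<close>
there. So the rearrangement of \<open>u\<close> decreases at most as fast as \<open>v\<close>, up to the error \<open>\<epsilon>\<close>.\<close>

lemma quantile_difference_antimono:
  fixes u u' v v' f :: "real \<Rightarrow> real"
  assumes L: "0 < L"
    and du: "\<And>x. x \<in> {0..L} \<Longrightarrow> (u has_real_derivative u' x) (at x within {0..L})"
    and cu': "continuous_on {0..L} u'"
    and ac: "abs_continuous_on_interval 0 L u'"
    and ode: "AE x in lebesgue_on {0<..<L}. (u' has_real_derivative - f x) (at x)"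
    and bc: "u' 0 = 0" "u' L = 0"
    and f: "integrable (lebesgue_on {0..L}) f" "(LINT x|lebesgue_on {0..L}. f x) = 0"
    and dv: "\<And>x. x \<in> {0..L} \<Longrightarrow> (v has_real_derivative v' x) (at x within {0..L})"
    and cv': "continuous_on {0..L} v'"
    and v': "\<And>\<tau>. 0 < \<tau> \<Longrightarrow> \<tau> < L \<Longrightarrow> v' \<tau> = - (LINT t|lebesgue_on {0..\<tau>}. decr_quantile L f t)"
    and st: "0 < s" "s \<le> t" "t < L"
  shows "v t - decr_quantile L u t \<le> v s - decr_quantile L u s"
proof -
  have eps: "v t - decr_quantile L u t - \<epsilon> * t \<le> v s - decr_quantile L u s - \<epsilon> * s" if "\<epsilon> > 0" for \<epsilon>
  proof -
    have "uniformly_continuous_on {0..L} v'"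
      by (rule compact_uniformly_continuous[OF cv']) simp
    then obtain \<delta> where \<delta>: "\<delta> > 0"
      "\<And>x y. x \<in> {0..L} \<Longrightarrow> y \<in> {0..L} \<Longrightarrow> dist y x < \<delta> \<Longrightarrow> dist (v' y) (v' x) < \<epsilon>"
      using \<open>\<epsilon> > 0\<close> unfolding uniformly_continuous_on_def by metis
    show ?thesis
    proof (rule antitone_if_locally_antitone[where h = "\<lambda>t. v t - decr_quantile L u t - \<epsilon> * t", OF \<delta>(1) _ st])
      fix p q assume pq: "0 < p" "p < q" "q < L" "q - p < \<delta>"
      have "(v has_real_derivative v' x) (at x)" if "p \<le> x" "x \<le> q" for x
        using dv[of x] at_within_Icc_at[of 0 x L] that pq by auto
      then obtain \<xi> where \<xi>: "p < \<xi>" "\<xi> < q" "v q - v p = (q - p) * v' \<xi>"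
        using MVT2[OF pq(2), of v v'] by blast
      have G: "(LINT t|lebesgue_on {0..\<tau>}. decr_quantile L f t) < - v' \<xi> + \<epsilon>" if "\<tau> \<in> {p..q}" for \<tau>
      proof -
        have "dist (v' \<tau>) (v' \<xi>) < \<epsilon>"
          using that pq \<xi> by (intro \<delta>(2)) (auto simp: dist_real_def)
        then show ?thesis using v'[of \<tau>] that pq by (auto simp: dist_real_def)
      qed
      have "0 < - v' \<xi> + \<epsilon>"
        using G[of \<xi>] quantile_integral_nonneg[OF L f, of \<xi>] \<xi> pq by auto
      from quantile_increment_le[OF L du cu' ac ode bc f(1) pq(1-3) this G]
      have "decr_quantile L u p - decr_quantile L u q \<le> (- v' \<xi> + \<epsilon>) * (q - p)" .
      then show "v q - decr_quantile L u q - \<epsilon> * q \<le> v p - decr_quantile L u p - \<epsilon> * p"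
        using \<xi>(3) by (simp add: algebra_simps)
    qed
  qed
  show ?thesis
  proof (rule field_le_epsilon)
    fix e :: real assume "e > 0"
    define \<epsilon> where "\<epsilon> = e / L"
    have "0 < \<epsilon>" using \<open>e > 0\<close> L by (simp add: \<epsilon>_def)
    from eps[OF this] have "v t - decr_quantile L u t \<le> v s - decr_quantile L u s + \<epsilon> * (t - s)"
      by (simp add: algebra_simps)
    also have "\<epsilon> * (t - s) \<le> \<epsilon> * L"
      using st \<open>0 < \<epsilon>\<close> by (intro mult_left_mono) auto
    also have "\<epsilon> * L = e" using L by (simp add: \<epsilon>_def)
    finally show "v t - decr_quantile L u t \<le> v s - decr_quantile L u s + e" by simp
  qed
qed

lemma neumann_solutionE:
  assumes "neumann_solution (\<lambda>x. F x) u" and "\<And>x. 0 < x \<Longrightarrow> x < pi \<Longrightarrow> F x = ereal (f x)"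
  obtains u' where "\<And>x. x \<in> {0..pi} \<Longrightarrow> (u has_real_derivative u' x) (at x within {0..pi})"
    "continuous_on {0..pi} u'" "abs_continuous_on_interval 0 pi u'"
    "AE x in lebesgue_on {0<..<pi}. (u' has_real_derivative - f x) (at x)"
    "u' 0 = 0" "u' pi = 0"
proof -
  from assms(1) obtain u' where u':
    "\<forall>x\<in>{0..pi}. (u has_real_derivative u' x) (at x within {0..pi})"
    "continuous_on {0..pi} u'" "abs_continuous_on_interval 0 pi u'"
    "AE x in lebesgue_on {0<..<pi}. \<exists>D. (u' has_real_derivative D) (at x) \<and> ereal (- D) = F x"
    "u' 0 = 0" "u' pi = 0"
    unfolding neumann_solution_def by blast
  have "AE x in lebesgue_on {0<..<pi}. (u' has_real_derivative - f x) (at x)"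
    using u'(4) AE_space
  proof eventually_elim
    case (elim x)
    then obtain D where D: "(u' has_real_derivative D) (at x)" "ereal (- D) = F x" by blast
    have "F x = ereal (f x)" using elim(2) by (intro assms(2)) auto
    then have "D = - f x" using D(2) by auto
    then show ?case using D(1) by simp
  qed
  then show thesis using that u' by blast
qed

section \<open>Convex order\<close>

lemma convex_subgradient:
  fixes \<phi> :: "real \<Rightarrow> real"
  assumes "convex_on UNIV \<phi>"
  obtains s where "\<And>y. \<phi> y \<ge> \<phi> x + s * (y - x)"
  using convex_le_Inf_differential[OF assms, of x] by (auto simp: interior_UNIV)

text \<open>A slope \<open>s\<close> that supports \<open>\<phi>\<close> at \<open>c\<close> still bounds \<open>\<phi>\<close> from below when started from another point
\<open>y\<close>, as long as one moves further away from \<open>c\<close>, because slopes increase.\<close>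

lemma convex_on_above_tangent_away:
  fixes \<phi> :: "real \<Rightarrow> real"
  assumes "convex_on UNIV \<phi>" and s: "\<And>y. \<phi> y \<ge> \<phi> c + s * (y - c)"
    and "c < y \<Longrightarrow> y \<le> z" "y < c \<Longrightarrow> z \<le> y"
  shows "\<phi> y + s * (z - y) \<le> \<phi> z"
proof -
  obtain s' where s': "\<And>z. \<phi> z \<ge> \<phi> y + s' * (z - y)" using convex_subgradient[OF assms(1), of y] by blast
  have "(s' - s) * (y - c) \<ge> 0"
    using s[of y] s'[of c] by (simp add: algebra_simps)
  then have "(s' - s) * (z - y) \<ge> 0" if "y \<noteq> c"
    using that assms(3,4) by (auto simp: zero_le_mult_iff)
  then show ?thesis
    using s'[of z] s[of z] by (cases "y = c") (auto simp: algebra_simps)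
qed

text \<open>The difference \<open>w - r\<close> increases with \<open>r\<close>, so there is a level \<open>c\<close> with \<open>w \<ge> r\<close> where \<open>r > c\<close> and
\<open>w \<le> r\<close> where \<open>r < c\<close>. With \<open>s\<close> a supporting slope at \<open>c\<close>, this gives
\<open>\<phi> w \<ge> \<phi> r + s * (w - r)\<close> everywhere, and the last term integrates to zero. Such a level need not
exist when \<open>w - r\<close> has constant sign, but then the equal means force \<open>r = w\<close> almost everywhere.\<close>

lemma integral_convex_le_if_difference_comonotone:
  fixes r w :: "'a \<Rightarrow> real"
  fixes \<phi> :: "real \<Rightarrow> real"
  assumes r: "integrable M r" and w: "integrable M w"
    and mean: "(LINT x|M. r x) = (LINT x|M. w x)"
    and conv: "convex_on UNIV \<phi>"
    and \<phi>r: "integrable M (\<lambda>x. \<phi> (r x))" and \<phi>w: "integrable M (\<lambda>x. \<phi> (w x))"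
    and S: "AE x in M. x \<in> S"
    and comono: "\<And>x y. x \<in> S \<Longrightarrow> y \<in> S \<Longrightarrow> r x < r y \<Longrightarrow> w x - r x \<le> w y - r y"
  shows "(LINT x|M. \<phi> (r x)) \<le> (LINT x|M. \<phi> (w x))"
proof (cases "(\<exists>x\<in>S. w x < r x) \<and> (\<exists>y\<in>S. r y < w y)")
  case True
  then obtain x0 y0 where x0: "x0 \<in> S" "w x0 < r x0" and y0: "y0 \<in> S" "r y0 < w y0" by blast
  \<comment> \<open>The crossing level is the supremum of the values of \<open>r\<close> at points where \<open>w\<close> lies below \<open>r\<close>.\<close>
  define C where "C = {r x | x. x \<in> S \<and> w x < r x}"
  define c where "c = Sup C"
  have "C \<noteq> {}" using x0 by (auto simp: C_def)
  have "bdd_above C"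
    by (rule bdd_aboveI[of _ "r y0"]) (use comono[OF y0(1)] y0(2) in \<open>force simp: C_def\<close>)
  obtain s where s: "\<And>y. \<phi> y \<ge> \<phi> c + s * (y - c)" using convex_subgradient[OF conv, of c] by blast
  have key: "\<phi> (r x) + s * (w x - r x) \<le> \<phi> (w x)" if "x \<in> S" for x
  proof (rule convex_on_above_tangent_away[OF conv s])
    show "r x \<le> w x" if "c < r x"
      using cSup_upper[OF _ \<open>bdd_above C\<close>, of "r x"] \<open>x \<in> S\<close> that by (force simp: c_def C_def)
    show "w x \<le> r x" if "r x < c"
    proof -
      have "r x < Sup C" using that by (simp add: c_def)
      then obtain z where "z \<in> S" "w z < r z" "r x < r z"
        using less_cSupD[OF \<open>C \<noteq> {}\<close>, of "r x"] unfolding C_def by blast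
      then show ?thesis using comono[OF \<open>x \<in> S\<close>, of z] by simp
    qed
  qed
  have "(LINT x|M. \<phi> (r x)) = (LINT x|M. \<phi> (r x) + s * (w x - r x))"
    using r w \<phi>r mean by simp
  also have "\<dots> \<le> (LINT x|M. \<phi> (w x))"
    using r w \<phi>r \<phi>w S by (intro integral_mono_AE) (auto elim!: eventually_mono intro: key)
  finally show ?thesis .
next
  case False
  have "AE x in M. r x = w x"
  proof -
    have i: "integrable M (\<lambda>x. w x - r x)" "integrable M (\<lambda>x. r x - w x)" using r w by auto
    have z: "(LINT x|M. w x - r x) = 0" "(LINT x|M. r x - w x) = 0" using r w mean by auto
    from False consider "\<forall>x\<in>S. r x \<le> w x" | "\<forall>x\<in>S. w x \<le> r x" by force
    then show ?thesis
    proof cases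
      case 1
      then have "AE x in M. 0 \<le> w x - r x" using S by (auto elim!: eventually_mono)
      then have "AE x in M. w x - r x = 0" using integral_nonneg_eq_0_iff_AE[OF i(1)] z by simp
      then show ?thesis by (auto elim!: eventually_mono)
    next
      case 2
      then have "AE x in M. 0 \<le> r x - w x" using S by (auto elim!: eventually_mono)
      then have "AE x in M. r x - w x = 0" using integral_nonneg_eq_0_iff_AE[OF i(2)] z by simp
      then show ?thesis by (auto elim!: eventually_mono)
    qed
  qed
  then have "(LINT x|M. \<phi> (r x)) = (LINT x|M. \<phi> (w x))"
    using \<phi>r \<phi>w by (intro integral_cong_AE) (auto elim!: eventually_mono)
  then show ?thesis by simp
qed

text \<open>Convexity of \<open>y powr p\<close> on the open half-line is extended to the end point \<open>0\<close> by
\<open>s powr p \<le> s\<close> for \<open>0 < s < 1\<close>.\<close>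

lemma convex_on_abs_powr:
  fixes p :: real assumes "1 \<le> p"
  shows "convex_on UNIV (\<lambda>y::real. \<bar>y\<bar> powr p)"
proof (rule convex_onI)
  have conv: "convex_on {0<..} (\<lambda>y::real. y powr p)" by (rule powr_convex[OF assms])
  have conv0: "((1 - t) * x + t * y) powr p \<le> (1 - t) * x powr p + t * y powr p"
    if "0 < t" "t < 1" "0 \<le> x" "0 \<le> y" for t x y :: real
  proof (cases "x = 0 \<or> y = 0")
    case False
    then show ?thesis using convex_onD[OF conv, of t x y] that by simp
  next
    case True
    have *: "(s * z) powr p \<le> s * z powr p" if "0 < s" "s < 1" "0 \<le> z" for s z :: real
    proof -
      have "s powr p \<le> s powr 1" using that assms by (intro powr_mono') auto
      then show ?thesis using that by (simp add: powr_mult mult_right_mono)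
    qed
    show ?thesis using True *[of t y] *[of "1 - t" x] that assms by auto
  qed
  fix t x y :: real assume t: "0 < t" "t < 1"
  have "\<bar>(1 - t) *\<^sub>R x + t *\<^sub>R y\<bar> \<le> (1 - t) * \<bar>x\<bar> + t * \<bar>y\<bar>"
    using t abs_triangle_ineq[of "(1 - t) * x" "t * y"] by (simp add: abs_mult)
  then have "\<bar>(1 - t) *\<^sub>R x + t *\<^sub>R y\<bar> powr p \<le> ((1 - t) * \<bar>x\<bar> + t * \<bar>y\<bar>) powr p"
    using assms by (intro powr_mono2) auto
  also have "\<dots> \<le> (1 - t) * \<bar>x\<bar> powr p + t * \<bar>y\<bar> powr p" using t by (intro conv0) auto
  finally show "\<bar>(1 - t) *\<^sub>R x + t *\<^sub>R y\<bar> powr p \<le> (1 - t) * \<bar>x\<bar> powr p + t * \<bar>y\<bar> powr p" .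
qed simp

lemma convex_on_max:
  fixes f g :: "real \<Rightarrow> real"
  assumes "convex_on UNIV f" "convex_on UNIV g"
  shows "convex_on UNIV (\<lambda>x. max (f x) (g x))"
proof (rule convex_onI)
  fix t x y :: real assume t: "0 < t" "t < 1"
  have "f ((1 - t) *\<^sub>R x + t *\<^sub>R y) \<le> (1 - t) * f x + t * f y"
       "g ((1 - t) *\<^sub>R x + t *\<^sub>R y) \<le> (1 - t) * g x + t * g y"
    using convex_onD[OF assms(1)] convex_onD[OF assms(2)] t by auto
  moreover have "(1 - t) * f x \<le> (1 - t) * max (f x) (g x)" "t * f y \<le> t * max (f y) (g y)"
       "(1 - t) * g x \<le> (1 - t) * max (f x) (g x)" "t * g y \<le> t * max (f y) (g y)"
    using t by (auto intro!: mult_left_mono)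
  ultimately show "max (f ((1 - t) *\<^sub>R x + t *\<^sub>R y)) (g ((1 - t) *\<^sub>R x + t *\<^sub>R y))
      \<le> (1 - t) * max (f x) (g x) + t * max (f y) (g y)" by linarith
qed simp

lemma convex_on_affine: "convex_on UNIV (\<lambda>x::real. a * x + b)"
  by (rule convex_onI) (auto simp: algebra_simps)

lemma integrable_convex_compose:
  fixes \<phi> g :: "real \<Rightarrow> real"
  assumes "convex_on UNIV \<phi>" "continuous_on {a..b} g"
  shows "integrable (lebesgue_on {a..b}) (\<lambda>x. \<phi> (g x))"
proof -
  have "continuous_on UNIV \<phi>" by (rule convex_on_continuous[OF open_UNIV assms(1)])
  then have "continuous_on {a..b} (\<lambda>x. \<phi> (g x))"
    using continuous_on_compose2[OF _ assms(2)] by blast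
  then show ?thesis by (rule continuous_imp_integrable_real)
qed

lemma max_on_attained:
  assumes "continuous_on {a..b} g" "a \<le> (b::real)"
  shows "\<exists>x\<in>{a..b}. max_on {a..b} g = g x" "x \<in> {a..b} \<Longrightarrow> g x \<le> max_on {a..b} g"
proof -
  obtain x0 where x0: "x0 \<in> {a..b}" "\<And>x. x \<in> {a..b} \<Longrightarrow> g x \<le> g x0"
    using continuous_attains_sup[OF compact_Icc _ assms(1)] assms(2) by auto
  then have "max_on {a..b} g = g x0"
    unfolding max_on_def by (intro Greatest_equality) auto
  then show "\<exists>x\<in>{a..b}. max_on {a..b} g = g x" "x \<in> {a..b} \<Longrightarrow> g x \<le> max_on {a..b} g"
    using x0 by auto
qed

lemma min_on_attained:
  assumes "continuous_on {a..b} g" "a \<le> (b::real)"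
  shows "\<exists>x\<in>{a..b}. min_on {a..b} g = g x" "x \<in> {a..b} \<Longrightarrow> min_on {a..b} g \<le> g x"
proof -
  obtain x0 where x0: "x0 \<in> {a..b}" "\<And>x. x \<in> {a..b} \<Longrightarrow> g x0 \<le> g x"
    using continuous_attains_inf[OF compact_Icc _ assms(1)] assms(2) by auto
  then have "min_on {a..b} g = g x0"
    unfolding min_on_def by (intro Least_equality) auto
  then show "\<exists>x\<in>{a..b}. min_on {a..b} g = g x" "x \<in> {a..b} \<Longrightarrow> min_on {a..b} g \<le> g x"
    using x0 by auto
qed

text \<open>Consequences of the convex order between two continuous functions. Each comes from a suitable convex
test function; for suprema and infima it is a hinge that vanishes on the range of \<open>v\<close>.\<close>

context
  fixes a b :: real and u v :: "real \<Rightarrow> real"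
  assumes ab: "a < b" and u: "continuous_on {a..b} u" and v: "continuous_on {a..b} v"
    and order: "\<And>\<phi>. convex_on UNIV \<phi> \<Longrightarrow>
      (LINT x|lebesgue_on {a..b}. \<phi> (u x)) \<le> (LINT x|lebesgue_on {a..b}. \<phi> (v x))"
begin

text \<open>The almost-everywhere form serves the essential supremum, where the range of \<open>v\<close> is only known up to
null sets.\<close>

lemma convex_order_AE_zero:
  assumes \<phi>: "convex_on UNIV \<phi>" "\<And>y. 0 \<le> \<phi> y" and "AE x in lebesgue_on {a..b}. \<phi> (v x) = 0"
  shows "AE x in lebesgue_on {a..b}. \<phi> (u x) = 0"
proof -
  note iu = integrable_convex_compose[OF \<phi>(1) u]
  have "(LINT x|lebesgue_on {a..b}. \<phi> (v x)) = 0"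
    using assms(3) by (rule integral_eq_zero_AE)
  then have "(LINT x|lebesgue_on {a..b}. \<phi> (u x)) \<le> 0" using order[OF \<phi>(1)] by simp
  moreover have "0 \<le> (LINT x|lebesgue_on {a..b}. \<phi> (u x))"
    by (rule Bochner_Integration.integral_nonneg) (rule \<phi>(2))
  ultimately have "(LINT x|lebesgue_on {a..b}. \<phi> (u x)) = 0" by simp
  then show ?thesis
    using integral_nonneg_eq_0_iff_AE[OF iu] \<phi>(2) by simp
qed

lemma convex_order_zero:
  assumes \<phi>: "convex_on UNIV \<phi>" "\<And>y. 0 \<le> \<phi> y" and "\<And>x. x \<in> {a..b} \<Longrightarrow> \<phi> (v x) = 0"
    and "x \<in> {a..b}"
  shows "\<phi> (u x) = 0"
proof -
  have "AE x in lebesgue_on {a..b}. \<phi> (u x) = 0"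
    using assms by (intro convex_order_AE_zero) (auto intro!: AE_I2)
  then have "(LINT x|lebesgue_on {a..b}. \<phi> (u x)) = 0" by (rule integral_eq_zero_AE)
  moreover have "continuous_on {a..b} (\<lambda>x. \<phi> (u x))"
    using continuous_on_compose2[OF convex_on_continuous[OF open_UNIV \<phi>(1)] u] by blast
  ultimately show ?thesis
    using integralL_eq_0_iff[OF _ ab, of "\<lambda>x. \<phi> (u x)"] \<phi>(2) assms(4) by simp
qed

lemma convex_order_max: "max_on {a..b} u \<le> max_on {a..b} v"
proof -
  let ?m = "max_on {a..b} v"
  obtain x where x: "x \<in> {a..b}" "max_on {a..b} u = u x"
    using max_on_attained(1)[OF u] ab by force
  have "max (1 * u x + (- ?m)) (0 * u x + 0) = 0"
    using max_on_attained(2)[OF v] ab x(1)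
    by (intro convex_order_zero[where \<phi> = "\<lambda>y. max (1 * y + (- ?m)) (0 * y + 0)"]
          convex_on_max convex_on_affine) auto
  then show ?thesis using x by simp
qed

lemma convex_order_min: "min_on {a..b} v \<le> min_on {a..b} u"
proof -
  let ?m = "min_on {a..b} v"
  obtain x where x: "x \<in> {a..b}" "min_on {a..b} u = u x"
    using min_on_attained(1)[OF u] ab by force
  have "max (-1 * u x + ?m) (0 * u x + 0) = 0"
    using min_on_attained(2)[OF v] ab x(1)
    by (intro convex_order_zero[where \<phi> = "\<lambda>y. max (-1 * y + ?m) (0 * y + 0)"]
          convex_on_max convex_on_affine) auto
  then show ?thesis using x by simp
qed

lemma convex_order_Lp_norm:
  fixes p :: ennreal
  assumes "1 \<le> p"
  shows "Lp_norm p (lebesgue_on {a..b}) u \<le> Lp_norm p (lebesgue_on {a..b}) v"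
proof (cases "p = \<infinity>")
  case True
  let ?M = "lebesgue_on {a..b}"
  have meas: "(\<lambda>x. ennreal \<bar>u x\<bar>) \<in> borel_measurable ?M"
    using continuous_imp_measurable_on_sets_lebesgue[OF u] by simp
  have "esssup ?M (\<lambda>x. ennreal \<bar>u x\<bar>) \<le> esssup ?M (\<lambda>x. ennreal \<bar>v x\<bar>)"
  proof (cases "esssup ?M (\<lambda>x. ennreal \<bar>v x\<bar>)")
    case (real K)
    have "AE x in ?M. ennreal \<bar>v x\<bar> \<le> ennreal K"
      using esssup_AE[of "\<lambda>x. ennreal \<bar>v x\<bar>" ?M] real by simp
    then have "AE x in ?M. max (max (1 * v x + (- K)) (-1 * v x + (- K))) (0 * v x + 0) = 0"
    proof eventually_elim
      case (elim x)
      then have "\<bar>v x\<bar> \<le> K" using real(1) by simp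
      then show ?case by (auto simp: max_def)
    qed
    then have "AE x in ?M. max (max (1 * u x + (- K)) (-1 * u x + (- K))) (0 * u x + 0) = 0"
      by (intro convex_order_AE_zero[where \<phi> = "\<lambda>y. max (max (1 * y + (- K)) (-1 * y + (- K))) (0 * y + 0)"]
          convex_on_max convex_on_affine) auto
    then have "AE x in ?M. ennreal \<bar>u x\<bar> \<le> ennreal K"
      by eventually_elim (auto simp: max_def split: if_splits intro!: ennreal_leI)
    then show ?thesis using esssup_I[OF meas] real by simp
  qed simp
  then show ?thesis using True by (simp add: Lp_norm_def)
next
  case False
  define q where "q = enn2real p"
  have "1 \<le> q"
    using assms False by (cases p) (auto simp: q_def top_ennreal.rep_eq)
  have conv: "convex_on UNIV (\<lambda>y::real. \<bar>y\<bar> powr q)" by (rule convex_on_abs_powr[OF \<open>1 \<le> q\<close>])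
  have I: "(\<integral>\<^sup>+x. ennreal (\<bar>g x\<bar> powr q) \<partial>lebesgue_on {a..b}) = ennreal (LINT x|lebesgue_on {a..b}. \<bar>g x\<bar> powr q)"
    if "continuous_on {a..b} g" for g
    using integrable_convex_compose[OF conv that] by (intro nn_integral_eq_integral) auto
  have "0 \<le> (LINT x|lebesgue_on {a..b}. \<bar>u x\<bar> powr q)" by (intro Bochner_Integration.integral_nonneg) simp
  then have "(LINT x|lebesgue_on {a..b}. \<bar>u x\<bar> powr q) powr (1 / q)
      \<le> (LINT x|lebesgue_on {a..b}. \<bar>v x\<bar> powr q) powr (1 / q)"
    using order[OF conv] \<open>1 \<le> q\<close> by (intro powr_mono2) auto
  moreover have "0 \<le> (LINT x|lebesgue_on {a..b}. \<bar>g x\<bar> powr q)" for g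
    by (intro Bochner_Integration.integral_nonneg) simp
  ultimately show ?thesis
    using False I[OF u] I[OF v] by (simp add: Lp_norm_def Let_def ennreal_leI flip: q_def)
qed

end

section \<open>The comparison theorem\<close>

text \<open>Let \<open>r\<close> be the rearrangement of \<open>u\<close>. It is equimeasurable with \<open>u\<close>, so \<open>u\<close> may be replaced by \<open>r\<close> on
the left, and \<open>r\<close> and \<open>v\<close> have mean zero. Both \<open>r\<close> and \<open>v - r\<close> are decreasing.\<close>

lemma neumann_convex_comparison:
  fixes f u v \<phi> :: "real \<Rightarrow> real"
  assumes f: "integrable (lebesgue_on {0..pi}) f" "zero_mean f"
    and u: "neumann_solution (\<lambda>x. ereal (f x)) u" "zero_mean u"
    and v: "neumann_solution (decr_rearr {0..pi} f) v" "zero_mean v"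
  shows "continuous_on {0..pi} u" "continuous_on {0..pi} v"
    and "convex_on UNIV \<phi> \<Longrightarrow>
      (LINT x|lebesgue_on {0..pi}. \<phi> (u x)) \<le> (LINT x|lebesgue_on {0..pi}. \<phi> (v x))"
proof -
  let ?M = "lebesgue_on {0..pi}" and ?q = "decr_quantile pi f" and ?r = "decr_quantile pi u"
  have fm: "f \<in> borel_measurable ?M" using f by simp
  obtain u' where u': "\<And>x. x \<in> {0..pi} \<Longrightarrow> (u has_real_derivative u' x) (at x within {0..pi})"
    "continuous_on {0..pi} u'" "abs_continuous_on_interval 0 pi u'"
    "AE x in lebesgue_on {0<..<pi}. (u' has_real_derivative - f x) (at x)"
    "u' 0 = 0" "u' pi = 0"
    using neumann_solutionE[OF u(1)] by blast
  obtain v' where v': "\<And>x. x \<in> {0..pi} \<Longrightarrow> (v has_real_derivative v' x) (at x within {0..pi})"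
    "continuous_on {0..pi} v'" "abs_continuous_on_interval 0 pi v'"
    "AE x in lebesgue_on {0<..<pi}. (v' has_real_derivative - ?q x) (at x)"
    "v' 0 = 0" "v' pi = 0"
    using neumann_solutionE[OF v(1) decr_rearr_eq_decr_quantile[OF fm]] by blast
  have qi: "integrable ?M ?q"
    using integrable_decr_quantile_iff[OF pi_gt_zero fm, of "\<lambda>x. x"] f(1) by simp
  show cu: "continuous_on {0..pi} u" and cv: "continuous_on {0..pi} v"
    using continuous_solution[OF pi_gt_zero u' f(1)] continuous_solution[OF pi_gt_zero v' qi] by auto
  have um: "u \<in> borel_measurable ?M" by (rule continuous_imp_measurable_on_sets_lebesgue[OF cu]) simp
  assume conv: "convex_on UNIV \<phi>"
  have \<phi>m: "\<phi> \<in> borel_measurable borel"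
    by (rule borel_measurable_continuous_onI[OF convex_on_continuous[OF open_UNIV conv]])
  have "(LINT x|?M. \<phi> (u x)) = (LINT t|?M. \<phi> (?r t))"
    using integral_decr_quantile[OF pi_gt_zero um \<phi>m] by simp
  also have "\<dots> \<le> (LINT t|?M. \<phi> (v t))"
  proof (rule integral_convex_le_if_difference_comonotone[OF _ _ _ conv _ _ , where S = "{0<..<pi}"])
    show "integrable ?M ?r"
      using integrable_decr_quantile_iff[OF pi_gt_zero um, of "\<lambda>x. x"] continuous_imp_integrable_real[OF cu]
      by simp
    show "integrable ?M v" by (rule continuous_imp_integrable_real[OF cv])
    show "(LINT t|?M. ?r t) = (LINT t|?M. v t)"
      using integral_decr_quantile[OF pi_gt_zero um, of "\<lambda>x. x"] u(2) v(2) by (simp add: zero_mean_def)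
    show "integrable ?M (\<lambda>t. \<phi> (?r t))"
      using integrable_decr_quantile_iff[OF pi_gt_zero um \<phi>m]
        integrable_convex_compose[OF conv cu] by simp
    show "integrable ?M (\<lambda>t. \<phi> (v t))" by (rule integrable_convex_compose[OF conv cv])
    show "AE t in ?M. t \<in> {0<..<pi}" using AE_Icc_interior[of 0 pi] by simp
    fix s t assume st: "s \<in> {0<..<pi}" "t \<in> {0<..<pi}" "?r s < ?r t"
    then have "t \<le> s" using decr_quantile_antimono[OF pi_gt_zero um, of s t] by fastforce
    have v'_eq: "v' \<tau> = - (LINT t|lebesgue_on {0..\<tau>}. ?q t)" if "0 < \<tau>" "\<tau> < pi" for \<tau>
      using derivative_eq_minus_integral[OF pi_gt_zero v' qi, of \<tau>] that by simp
    show "v s - ?r s \<le> v t - ?r t"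
      by (rule quantile_difference_antimono[OF pi_gt_zero u' f(1) _ v'(1,2) v'_eq])
         (use st \<open>t \<le> s\<close> f(2) in \<open>auto simp: zero_mean_def\<close>)
  qed
  finally show "(LINT x|?M. \<phi> (u x)) \<le> (LINT x|?M. \<phi> (v x))" .
qed

theorem theorem1p5:
  fixes f u v :: "real \<Rightarrow> real"
  assumes "integrable (lebesgue_on {0..pi}) f"
    and "zero_mean f"
    and "neumann_solution (\<lambda>x. ereal (f x)) u"
    and "neumann_solution (decr_rearr {0..pi} f) v"
    and "zero_mean u"
    and "zero_mean v"
  shows "(\<forall>\<phi> :: real \<Rightarrow> real. convex_on UNIV \<phi> \<longrightarrow>
            (LINT x|lebesgue_on {0..pi}. \<phi> (u x)) \<le> (LINT x|lebesgue_on {0..pi}. \<phi> (v x)))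
       \<and> (\<forall>p :: ennreal. 1 \<le> p \<longrightarrow>
            Lp_norm p (lebesgue_on {0..pi}) u \<le> Lp_norm p (lebesgue_on {0..pi}) v)
       \<and> max_on {0..pi} u \<le> max_on {0..pi} v
       \<and> min_on {0..pi} v \<le> min_on {0..pi} u
       \<and> osc_on {0..pi} u \<le> osc_on {0..pi} v"
proof -
  note cmp = neumann_convex_comparison[OF assms(1,2,3,5,4,6)]
  have max: "max_on {0..pi} u \<le> max_on {0..pi} v"
    by (rule convex_order_max[OF pi_gt_zero cmp])
  have min: "min_on {0..pi} v \<le> min_on {0..pi} u"
    by (rule convex_order_min[OF pi_gt_zero cmp])
  have osc: "osc_on {0..pi} u \<le> osc_on {0..pi} v"
    using max min by (simp add: osc_on_def)
  show ?thesis
    by (intro conjI allI impI max min osc cmp(3) convex_order_Lp_norm[OF pi_gt_zero cmp]) assumption+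
qed

end
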